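(* For every triangle-free, $2$-connected, outerplanar graph $G$, we have $\vec{\chi}(G)\leq 3$. Moreover, the bound is tight: there exists a triangle-free, $2$-connected, outerplanar graph $G$ with $\vec{\chi}(G)=3$.
   Context: All graphs are finite, without loops or multiple edges. An orientation of a graph $G$ is a digraph obtained from $G$ by replacing each edge by exactly one of the two possible arcs with the same end-vertices. For an orientation $D$ and vertex $v$, $d^-_D(v)$ denotes the in-degree of $v$ in $D$. An orientation $D$ of $G$ is proper if $d^-_D(u)\neq d^-_D(v)$ for every edge $uv$ of $G$. The proper orientation number $\vec{\chi}(G)$ is the minimum integer $k$ such that $G$ has a proper orientation with maximum in-degree at most $k$. A graph is outerplanar if it has a planar embedding in which all vertices lie on the boundary of a single face. *)

theory Defs
  imports
    "HOL-Analysis.Analysis"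
    "Graph_Theory.Digraph_Component"
    "Graph_Theory.Pair_Digraph"
begin

text \<open>
  A finite simple graph is a \<open>pair_graph\<close>: a finite symmetric loop-free relation, in which
  an undirected edge \<open>uv\<close> appears as the two pairs \<open>(u, v)\<close> and \<open>(v, u)\<close>.
\<close>

section \<open>Proper orientations\<close>

definition orientation :: "'a pair_pre_digraph \<Rightarrow> 'a pair_pre_digraph \<Rightarrow> bool" where
  "orientation G D \<longleftrightarrow>
     pverts D = pverts G \<and> parcs D \<subseteq> parcs G \<and>
     (\<forall>(u, v) \<in> parcs G. (u, v) \<in> parcs D \<longleftrightarrow> (v, u) \<notin> parcs D)"

definition proper_orientation :: "'a pair_pre_digraph \<Rightarrow> 'a pair_pre_digraph \<Rightarrow> bool" where
  "proper_orientation G D \<longleftrightarrow>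
     orientation G D \<and>
     (\<forall>(u, v) \<in> parcs G. in_degree (with_proj D) u \<noteq> in_degree (with_proj D) v)"

text \<open>The minimum exists for every finite simple graph, see \<open>ex_proper_orientation\<close> below.\<close>

definition proper_orientation_number :: "'a pair_pre_digraph \<Rightarrow> nat" where
  "proper_orientation_number G =
     (LEAST k. \<exists>D. proper_orientation G D \<and>
        (\<forall>v \<in> pverts G. in_degree (with_proj D) v \<le> k))"


section \<open>Triangle-free and k-connected graphs\<close>

definition triangle_free :: "'a pair_pre_digraph \<Rightarrow> bool" where
  "triangle_free G \<longleftrightarrow>
     \<not> (\<exists>u v w. (u, v) \<in> parcs G \<and> (v, w) \<in> parcs G \<and> (w, u) \<in> parcs G)"

text \<open>
  The name \<open>connected\<close> is qualified because it also denotes topological connectedness.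
\<close>

definition k_connected :: "nat \<Rightarrow> 'a pair_pre_digraph \<Rightarrow> bool" where
  "k_connected k G \<longleftrightarrow>
     k < card (pverts G) \<and>
     (\<forall>X \<subseteq> pverts G. card X < k \<longrightarrow>
        Digraph_Component.connected (induce_subgraph (with_proj G) (pverts G - X)))"


section \<open>Plane embeddings and outerplanarity\<close>

text \<open>
  The plane is \<open>complex\<close>. The vertex \<open>v\<close> is drawn as the point \<open>p v\<close> and the edge \<open>uv\<close> as the
  image of the arc \<open>c (u, v)\<close>; the pair \<open>(v, u)\<close> is the same curve traversed backwards.
\<close>

definition plane_embedding ::
  "'a pair_pre_digraph \<Rightarrow> ('a \<Rightarrow> complex) \<Rightarrow> ('a \<times> 'a \<Rightarrow> real \<Rightarrow> complex) \<Rightarrow> bool" where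
  "plane_embedding G p c \<longleftrightarrow>
     inj_on p (pverts G) \<and>
     (\<forall>(u, v) \<in> parcs G.
        arc (c (u, v)) \<and> pathstart (c (u, v)) = p u \<and> pathfinish (c (u, v)) = p v \<and>
        c (v, u) = reversepath (c (u, v)) \<and>
        path_image (c (u, v)) \<inter> p ` pverts G = {p u, p v}) \<and>
     (\<forall>(u, v) \<in> parcs G. \<forall>(x, y) \<in> parcs G. {u, v} \<noteq> {x, y} \<longrightarrow>
        path_image (c (u, v)) \<inter> path_image (c (x, y)) \<subseteq> p ` pverts G)"

definition drawing ::
  "'a pair_pre_digraph \<Rightarrow> ('a \<Rightarrow> complex) \<Rightarrow> ('a \<times> 'a \<Rightarrow> real \<Rightarrow> complex) \<Rightarrow> complex set" where
  "drawing G p c = p ` pverts G \<union> (\<Union>e \<in> parcs G. path_image (c e))"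

definition faces ::
  "'a pair_pre_digraph \<Rightarrow> ('a \<Rightarrow> complex) \<Rightarrow> ('a \<times> 'a \<Rightarrow> real \<Rightarrow> complex) \<Rightarrow> complex set set" where
  "faces G p c = components (- drawing G p c)"

definition outerplanar :: "'a pair_pre_digraph \<Rightarrow> bool" where
  "outerplanar G \<longleftrightarrow>
     (\<exists>p c. plane_embedding G p c \<and> (\<exists>F \<in> faces G p c. p ` pverts G \<subseteq> frontier F))"


section \<open>Existence of proper orientations\<close>

text \<open>
  Direct all edges at a vertex of maximum degree towards it, and recurse on the remaining graph.
\<close>

lemma ex_proper_orientation_rel:
  fixes R :: "'a rel"
  assumes "finite V" "R \<subseteq> V \<times> V" "sym R" "irrefl R"
    and "\<forall>v. card (R `` {v}) \<le> d"
  shows "\<exists>A \<subseteq> R. (\<forall>(u, v) \<in> R. (u, v) \<in> A \<longleftrightarrow> (v, u) \<notin> A) \<and>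
           (\<forall>(u, v) \<in> R. card {w. (w, u) \<in> A} \<noteq> card {w. (w, v) \<in> A}) \<and>
           (\<forall>v. card {w. (w, v) \<in> A} \<le> d)"
  using assms
proof (induction "card V" arbitrary: V R d)
  case 0
  then show ?case by auto
next
  case (Suc n)
  define f where "f v = card (R `` {v})" for v
  have ne: "V \<noteq> {}" using Suc.hyps(2) by auto
  then obtain z where z: "z \<in> V" "\<And>v. v \<in> V \<Longrightarrow> f v \<le> f z"
  proof -
    have "Max (f ` V) \<in> f ` V" using ne Suc.prems(1) by (intro Max_in) auto
    then obtain z where "z \<in> V" "f z = Max (f ` V)" by auto
    then show thesis using that Suc.prems(1) by simp
  qed
  have fz: "f v \<le> f z" for v
  proof (cases "v \<in> V")
    case False
    then have "R `` {v} = {}" using Suc.prems(2) by auto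
    then show ?thesis by (simp add: f_def)
  qed (use z in auto)
  define S where "S = {(u, v) \<in> R. u \<noteq> z \<and> v \<noteq> z}"
  have fin: "finite (R `` {v})" for v
    by (rule finite_subset[OF _ Suc.prems(1)]) (use Suc.prems(2) in auto)
  have S1: "S \<subseteq> (V - {z}) \<times> (V - {z})" "sym S" "irrefl S" "S \<subseteq> R"
    using Suc.prems by (auto simp: S_def sym_def irrefl_def)
  have "card (S `` {v}) \<le> f z" for v
    using fz[of v] card_mono[OF fin[of v], of "S `` {v}"] S1(4) unfolding f_def
    by (meson Image_mono le_trans order_refl)
  then have deg: "\<forall>v. card (S `` {v}) \<le> f z" by blast
  have "n = card (V - {z})" using Suc.hyps(2) Suc.prems(1) z(1) by simp
  from Suc.hyps(1)[OF this finite_Diff[OF Suc.prems(1)] S1(1-3) deg]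
  obtain A where "A \<subseteq> S \<and> (\<forall>(u, v) \<in> S. (u, v) \<in> A \<longleftrightarrow> (v, u) \<notin> A) \<and>
      (\<forall>(u, v) \<in> S. card {w. (w, u) \<in> A} \<noteq> card {w. (w, v) \<in> A}) \<and>
      (\<forall>v. card {w. (w, v) \<in> A} \<le> f z)"
    by (rule exE)
  then have A: "A \<subseteq> S" "\<forall>(u, v) \<in> S. (u, v) \<in> A \<longleftrightarrow> (v, u) \<notin> A"
      "\<forall>(u, v) \<in> S. card {w. (w, u) \<in> A} \<noteq> card {w. (w, v) \<in> A}"
    by simp_all
  define B where "B = A \<union> R \<inter> UNIV \<times> {z}"
  have irr: "(x, x) \<notin> R" for x using Suc.prems(4) by (auto simp: irrefl_def)
  have sy: "(x, y) \<in> R \<longleftrightarrow> (y, x) \<in> R" for x y using Suc.prems(3) by (auto simp: sym_def)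
  have AS: "(x, y) \<in> A \<Longrightarrow> (x, y) \<in> R \<and> x \<noteq> z \<and> y \<noteq> z" for x y
    using A(1) by (auto simp: S_def)
  have Bz: "{w. (w, z) \<in> B} = R `` {z}" using AS sy by (auto simp: B_def)
  have Bv: "{w. (w, v) \<in> B} = {w. (w, v) \<in> A}" if "v \<noteq> z" for v
    using that by (auto simp: B_def)
  have le: "card {w. (w, v) \<in> B} \<le> f v" for v
    unfolding f_def using AS sy by (intro card_mono fin) (auto simp: B_def)
  have lt: "card {w. (w, v) \<in> B} < f z" if "(v, z) \<in> R" for v
  proof -
    have vz: "v \<noteq> z" using that irr by auto
    have "card {w. (w, v) \<in> A} < card (R `` {v})"
    proof (intro psubset_card_mono fin psubsetI)
      show "{w. (w, v) \<in> A} \<subseteq> R `` {v}" using AS sy by auto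
      show "{w. (w, v) \<in> A} \<noteq> R `` {v}" using AS that by (metis Image_singleton_iff mem_Collect_eq)
    qed
    then show ?thesis using fz[of v] Bv[OF vz] by (simp add: f_def)
  qed
  show ?case
  proof (intro exI[of _ B] conjI)
    show "B \<subseteq> R" using AS by (auto simp: B_def)
    show "\<forall>(u, v) \<in> R. (u, v) \<in> B \<longleftrightarrow> (v, u) \<notin> B"
    proof (intro ballI, clarify)
      fix u v assume uv: "(u, v) \<in> R"
      then consider "u = z" "v \<noteq> z" | "v = z" "u \<noteq> z" | "(u, v) \<in> S"
        using irr by (auto simp: S_def)
      then show "(u, v) \<in> B \<longleftrightarrow> (v, u) \<notin> B"
      proof cases
        case 3
        then show ?thesis using A(2) by (auto simp: B_def S_def)
      qed (use AS sy uv in \<open>auto simp: B_def\<close>)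
    qed
    show "\<forall>(u, v) \<in> R. card {w. (w, u) \<in> B} \<noteq> card {w. (w, v) \<in> B}"
    proof (intro ballI, clarify)
      fix u v assume uv: "(u, v) \<in> R" and eq: "card {w. (w, u) \<in> B} = card {w. (w, v) \<in> B}"
      then consider "u = z" | "v = z" | "(u, v) \<in> S" "u \<noteq> z" "v \<noteq> z"
        by (auto simp: S_def)
      then show False
      proof cases
        case 1
        then show ?thesis using lt[of v] uv sy eq Bz by (simp add: f_def)
      next
        case 2
        then show ?thesis using lt[of u] uv eq Bz by (simp add: f_def)
      next
        case 3
        then show ?thesis using A(3) eq Bv by auto
      qed
    qed
    show "\<forall>v. card {w. (w, v) \<in> B} \<le> d"
      using le Suc.prems(5) unfolding f_def by (meson le_trans)
  qed
qed

lemma ex_proper_orientation: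
  assumes "pair_graph G"
  shows "\<exists>k D. proper_orientation G D \<and> (\<forall>v \<in> pverts G. in_degree (with_proj D) v \<le> k)"
proof -
  interpret pair_graph G by fact
  have sub: "parcs G \<subseteq> pverts G \<times> pverts G" using in_arcsD1 in_arcsD2 by auto
  have ss: "sym (parcs G)" "irrefl (parcs G)"
    using arcs_symmetric no_loops' by (auto simp: sym_def irrefl_def)
  have "\<forall>v. card (parcs G `` {v}) \<le> card (pverts G)"
    using sub pair_finite_verts by (auto intro!: card_mono)
  from ex_proper_orientation_rel[OF pair_finite_verts sub ss this]
  obtain A where A: "A \<subseteq> parcs G" "\<forall>(u, v) \<in> parcs G. (u, v) \<in> A \<longleftrightarrow> (v, u) \<notin> A"
      "\<forall>(u, v) \<in> parcs G. card {w. (w, u) \<in> A} \<noteq> card {w. (w, v) \<in> A}"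
      "\<forall>v. card {w. (w, v) \<in> A} \<le> card (pverts G)"
    by blast
  define D where "D = \<lparr>pverts = pverts G, parcs = A\<rparr>"
  have deg: "in_degree (with_proj D) v = card {w. (w, v) \<in> A}" for v
  proof -
    have "in_arcs (with_proj D) v = (\<lambda>w. (w, v)) ` {w. (w, v) \<in> A}"
      by (auto simp: in_arcs_def D_def)
    then show ?thesis unfolding in_degree_def by (simp add: card_image inj_on_def)
  qed
  have "proper_orientation G D"
    using A unfolding proper_orientation_def orientation_def deg by (simp add: D_def)
  moreover have "\<forall>v \<in> pverts G. in_degree (with_proj D) v \<le> card (pverts G)"
    using A(4) deg by simp
  ultimately show ?thesis by blast
qed

end

theory Submission
  imports Defs
begin

text \<open>
  In an outerplanar graph no two vertices are joined by three disjoint paths that all have inner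
  vertices: the inner vertices would lie on the frontier of one face of a theta curve. In a
  2-connected graph this makes a longest cycle Hamiltonian, and without triangles no two of its
  chords cross. Hence the graph arises from an edge by repeatedly attaching a path of at least three
  edges to an edge \<open>uv\<close>. For the part attached to \<open>uv\<close> one records the quadruples
  \<open>(a, b, x, y)\<close> such that it can be oriented with \<open>u\<close>, \<open>v\<close> of final in-degrees \<open>a\<close>, \<open>b\<close>, to which
  the part contributes \<open>x\<close>, \<open>y\<close>. With in-degrees up to 3, every part allows one of two fixed sets of
  quadruples, and both contain \<open>(0, 1, 0, 0)\<close>.

  Tightness: let an edge \<open>uv\<close> carry a path of four edges. If in-degrees are at most 2, then \<open>u\<close> and
  \<open>v\<close> cannot both be entered from outside the resulting pentagon. A chain of faces of lengths
  5, 4, 5, 4, 5 violates this at one of its two ends.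
\<close>

section \<open>Profiles of graphs with two terminals\<close>

text \<open>
  In a profile \<open>(a, b, x, y)\<close> of a graph with terminals \<open>u\<close> and \<open>v\<close>, the prescribed in-degrees \<open>a\<close>,
  \<open>b\<close> of the terminals may exceed the in-degrees \<open>x\<close>, \<open>y\<close> within the graph: further arcs come from
  the graphs glued to it.
\<close>

type_synonym profile = "nat \<times> nat \<times> nat \<times> nat"

definition add_edge :: "profile set \<Rightarrow> profile set" where
  "add_edge P = {(a, b, x, y). a \<noteq> b \<and> (0 < x \<and> (a, b, x - 1, y) \<in> P \<or> 0 < y \<and> (a, b, x, y - 1) \<in> P)}"

definition glue :: "profile set \<Rightarrow> profile set \<Rightarrow> profile set" where
  "glue P Q = {(a, b, x, z). \<exists>c y y'. (a, c, x, y) \<in> P \<and> (c, b, y', z) \<in> Q \<and> c = y + y'}"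

definition free_profiles :: "profile list" where
  "free_profiles = [(a, b, 0, 0). a \<leftarrow> [0..<4], b \<leftarrow> [0..<4], a \<noteq> b]"

text \<open>
  A path of four edges whose ends have final in-degrees 1 and 2 cannot send all its arcs away from
  the ends. The last four profiles make up for the two missing ones.
\<close>

definition pentagon_profiles :: "profile list" where
  "pentagon_profiles =
     [(a, b, 0, 0). a \<leftarrow> [0..<4], b \<leftarrow> [0..<4], a \<noteq> b \<and> (a, b) \<noteq> (1, 2) \<and> (a, b) \<noteq> (2, 1)] @
     [(1, 3, 0, 1), (2, 3, 0, 1), (3, 1, 1, 0), (3, 2, 1, 0)]"

definition flexible :: "profile set \<Rightarrow> bool" where
  "flexible P \<longleftrightarrow> set free_profiles \<subseteq> P \<or> set pentagon_profiles \<subseteq> P"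

text \<open>The profiles common to all chains of at least four blocks.\<close>

definition long_profiles :: "profile list" where
  "long_profiles = [(a, b, x, y). a \<leftarrow> [0..<4], b \<leftarrow> [0..<4], x \<leftarrow> [0..<min 2 (Suc a)], y \<leftarrow> [0..<min 2 (Suc b)],
     x + y > 0 \<or> (a, b) \<noteq> (1, 2) \<and> (a, b) \<noteq> (2, 1) \<and> (a, b) \<noteq> (2, 2)]"

text \<open>
  A block is an edge together with the part attached to it; a chain consists of blocks glued in a
  row at single vertices.
\<close>

inductive chain :: "nat \<Rightarrow> profile set \<Rightarrow> bool" where
  single: "flexible P \<Longrightarrow> add_edge P \<subseteq> S \<Longrightarrow> chain 1 S"
| cons: "flexible P \<Longrightarrow> chain k Q \<Longrightarrow> glue (add_edge P) Q \<subseteq> S \<Longrightarrow> chain (Suc k) S"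

definition add_edge_list :: "profile list \<Rightarrow> profile list" where
  "add_edge_list ps = [(a, b, Suc x, y). (a, b, x, y) \<leftarrow> ps] @ [(a, b, x, Suc y). (a, b, x, y) \<leftarrow> ps]"

definition glue_list :: "profile list \<Rightarrow> profile list \<Rightarrow> profile list" where
  "glue_list ps qs = remdups [(a, b, x, z). (a, c, x, y) \<leftarrow> ps, (c', b, y', z) \<leftarrow> qs, c = c' \<and> c = y + y']"

definition block_lists :: "profile list list" where
  "block_lists = [add_edge_list free_profiles, add_edge_list pentagon_profiles]"

fun chain_lists :: "nat \<Rightarrow> profile list list" where
  "chain_lists 0 = block_lists"
| "chain_lists (Suc k) = [glue_list p q. p \<leftarrow> block_lists, q \<leftarrow> chain_lists k]"

lemma add_edge_mono: "P \<subseteq> Q \<Longrightarrow> add_edge P \<subseteq> add_edge Q"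
  unfolding add_edge_def by blast

lemma glue_mono: "P \<subseteq> P' \<Longrightarrow> Q \<subseteq> Q' \<Longrightarrow> glue P Q \<subseteq> glue P' Q'"
  unfolding glue_def by blast

lemma set_glue_list: "set (glue_list ps qs) = glue (set ps) (set qs)"
  unfolding glue_list_def glue_def by force

lemma block_covers:
  assumes "flexible P"
  obtains p where "p \<in> set block_lists" "set p \<subseteq> add_edge P"
proof -
  have sub: "set (add_edge_list ps) \<subseteq> add_edge (set ps)" if "\<forall>(a, b, x, y) \<in> set ps. a \<noteq> b" for ps
    using that by (force simp: add_edge_list_def add_edge_def)
  have "set (add_edge_list free_profiles) \<subseteq> add_edge (set free_profiles)"
    by (rule sub) (auto simp: free_profiles_def)
  moreover have "set (add_edge_list pentagon_profiles) \<subseteq> add_edge (set pentagon_profiles)"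
    by (rule sub) (auto simp: pentagon_profiles_def)
  ultimately show thesis
    using assms add_edge_mono that unfolding flexible_def block_lists_def
    by (meson list.set_intros subset_trans)
qed

lemma chain_covers:
  assumes "chain (Suc k) S"
  shows "\<exists>p \<in> set (chain_lists k). set p \<subseteq> S"
  using assms
proof (induction k arbitrary: S)
  case 0
  then show ?case
    by cases (auto elim!: block_covers elim: chain.cases)
next
  case (Suc k)
  then obtain P Q where PQ: "flexible P" "chain (Suc k) Q" "glue (add_edge P) Q \<subseteq> S"
    by (auto elim: chain.cases)
  obtain p where p: "p \<in> set block_lists" "set p \<subseteq> add_edge P" using block_covers[OF PQ(1)] .
  obtain q where q: "q \<in> set (chain_lists k)" "set q \<subseteq> Q" using Suc.IH[OF PQ(2)] by blast
  have "set (glue_list p q) \<subseteq> S" using glue_mono[OF p(2) q(2)] PQ(3) by (simp add: set_glue_list)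
  then show ?case using p(1) q(1) by auto
qed

lemma chain_lists_2: "\<forall>p \<in> set (chain_lists 2).
   list_all (\<lambda>t. t \<in> set p) free_profiles \<or> list_all (\<lambda>t. t \<in> set p) pentagon_profiles"
  by code_simp

lemma chain_lists_3: "\<forall>p \<in> set block_lists. \<forall>q \<in> set (chain_lists 2).
   list_all (\<lambda>(a, b, x, z). \<exists>(a', c, x', y) \<in> set p.
     a' = a \<and> x' = x \<and> y \<le> c \<and> (c, b, c - y, z) \<in> set q) long_profiles"
  by code_simp

lemma long_step: "\<forall>p \<in> set block_lists.
   list_all (\<lambda>(a, b, x, z). \<exists>(a', c, x', y) \<in> set p.
     a' = a \<and> x' = x \<and> y \<le> c \<and> (c, b, c - y, z) \<in> set long_profiles) long_profiles"
  by code_simp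

lemma pentagon_long: "list_all (\<lambda>t. t \<in> set long_profiles) pentagon_profiles"
  by code_simp

lemma sub_glueI:
  assumes "list_all (\<lambda>(a, b, x, z). \<exists>(a', c, x', y) \<in> set p.
     a' = a \<and> x' = x \<and> y \<le> c \<and> (c, b, c - y, z) \<in> Q) r"
  shows "set r \<subseteq> glue (set p) Q"
proof
  fix t assume "t \<in> set r"
  moreover obtain a b x z where "t = (a, b, x, z)" by (metis surj_pair)
  ultimately show "t \<in> glue (set p) Q"
    using assms unfolding list_all_iff glue_def by fastforce
qed

lemma long_chain: "chain k S \<Longrightarrow> k \<ge> 4 \<Longrightarrow> set long_profiles \<subseteq> S"
proof (induction rule: chain.induct)
  case (cons P k Q S)
  obtain p where p: "p \<in> set block_lists" "set p \<subseteq> add_edge P" using block_covers[OF cons(1)] .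
  show ?case
  proof (cases "k \<ge> 4")
    case True
    have "set long_profiles \<subseteq> glue (set p) (set long_profiles)"
      using long_step p(1) by (intro sub_glueI) blast
    then show ?thesis using glue_mono[OF p(2) cons.IH[OF True]] cons(3) by blast
  next
    case False
    then have "k = Suc 2" using cons by simp
    then obtain q where q: "q \<in> set (chain_lists 2)" "set q \<subseteq> Q" using chain_covers cons(2) by blast
    have "set long_profiles \<subseteq> glue (set p) (set q)"
      using chain_lists_3 p(1) q(1) by (intro sub_glueI) blast
    then show ?thesis using glue_mono[OF p(2) q(2)] cons(3) by blast
  qed
qed simp

lemma chain_flexible:
  assumes "chain k S" "k \<ge> 3"
  shows "flexible S"
proof (cases "k = 3")
  case True
  then have "chain (Suc 2) S" using assms by simp
  then obtain p where p: "p \<in> set (chain_lists 2)" "set p \<subseteq> S" using chain_covers by blast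
  then show ?thesis using chain_lists_2 unfolding flexible_def list_all_iff by blast
next
  case False
  then have "set long_profiles \<subseteq> S" using long_chain assms by simp
  then show ?thesis using pentagon_long unfolding flexible_def list_all_iff by blast
qed

section \<open>Noncrossing chords in a polygon\<close>

definition profiles :: "'a set \<Rightarrow> 'a rel \<Rightarrow> 'a \<Rightarrow> 'a \<Rightarrow> profile set" where
  "profiles V R u v = {(a, b, x, y). \<exists>A c. A \<subseteq> R \<and>
     (\<forall>(p, q) \<in> R. (p, q) \<in> A \<longleftrightarrow> (q, p) \<notin> A) \<and> (\<forall>(p, q) \<in> R. c p \<noteq> c q) \<and>
     (\<forall>w \<in> V. c w \<le> 3) \<and> (\<forall>w \<in> V - {u, v}. card {z. (z, w) \<in> A} = c w) \<and>
     c u = a \<and> c v = b \<and> card {z. (z, u) \<in> A} = x \<and> card {z. (z, v) \<in> A} = y}"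

lemma profilesI:
  assumes "A \<subseteq> R" "\<And>p q. (p, q) \<in> R \<Longrightarrow> (p, q) \<in> A \<longleftrightarrow> (q, p) \<notin> A"
    "\<And>p q. (p, q) \<in> R \<Longrightarrow> c p \<noteq> c q" "\<And>w. w \<in> V \<Longrightarrow> c w \<le> 3"
    "\<And>w. w \<in> V \<Longrightarrow> w \<noteq> u \<Longrightarrow> w \<noteq> v \<Longrightarrow> card {z. (z, w) \<in> A} = c w"
    "c u = a" "c v = b" "card {z. (z, u) \<in> A} = x" "card {z. (z, v) \<in> A} = y"
  shows "(a, b, x, y) \<in> profiles V R u v"
  unfolding profiles_def mem_Collect_eq prod.case
  by (rule exI[of _ A], rule exI[of _ c]) (use assms in auto)

lemma profilesE:
  assumes "(a, b, x, y) \<in> profiles V R u v"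
  obtains A c where "A \<subseteq> R" "\<forall>p q. (p, q) \<in> R \<longrightarrow> ((p, q) \<in> A \<longleftrightarrow> (q, p) \<notin> A)"
    "\<forall>p q. (p, q) \<in> R \<longrightarrow> c p \<noteq> c q" "\<forall>w. w \<in> V \<longrightarrow> c w \<le> 3"
    "\<forall>w. w \<in> V \<longrightarrow> w \<noteq> u \<longrightarrow> w \<noteq> v \<longrightarrow> card {z. (z, w) \<in> A} = c w"
    "c u = a" "c v = b" "card {z. (z, u) \<in> A} = x" "card {z. (z, v) \<in> A} = y"
proof -
  obtain A c where *: "A \<subseteq> R \<and>
     (\<forall>(p, q) \<in> R. (p, q) \<in> A \<longleftrightarrow> (q, p) \<notin> A) \<and> (\<forall>(p, q) \<in> R. c p \<noteq> c q) \<and>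
     (\<forall>w \<in> V. c w \<le> 3) \<and> (\<forall>w \<in> V - {u, v}. card {z. (z, w) \<in> A} = c w) \<and>
     c u = a \<and> c v = b \<and> card {z. (z, u) \<in> A} = x \<and> card {z. (z, v) \<in> A} = y"
    using assms unfolding profiles_def mem_Collect_eq prod.case by (elim exE)
  show thesis by (rule that[of A c]) (use * in auto)
qed

lemma glue_profiles:
  assumes fin: "finite V1" "finite V2" and R1: "R1 \<subseteq> V1 \<times> V1" and R2: "R2 \<subseteq> V2 \<times> V2"
    and V: "V1 \<inter> V2 = {m}" "u \<in> V1 - {m}" "v \<in> V2 - {m}"
  shows "glue (profiles V1 R1 u m) (profiles V2 R2 m v) \<subseteq> profiles (V1 \<union> V2) (R1 \<union> R2) u v"
proof clarify
  fix a b x z assume "(a, b, x, z) \<in> glue (profiles V1 R1 u m) (profiles V2 R2 m v)"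
  then obtain d y y' where 1: "(a, d, x, y) \<in> profiles V1 R1 u m"
    and 2: "(d, b, y', z) \<in> profiles V2 R2 m v" and d: "d = y + y'"
    unfolding glue_def by blast
  from 1 obtain A1 c1 where A1: "A1 \<subseteq> R1" "\<forall>p q. (p, q) \<in> R1 \<longrightarrow> ((p, q) \<in> A1 \<longleftrightarrow> (q, p) \<notin> A1)"
    and c1: "\<forall>p q. (p, q) \<in> R1 \<longrightarrow> c1 p \<noteq> c1 q" "\<forall>w. w \<in> V1 \<longrightarrow> c1 w \<le> 3"
    "\<forall>w. w \<in> V1 \<longrightarrow> w \<noteq> u \<longrightarrow> w \<noteq> m \<longrightarrow> card {z. (z, w) \<in> A1} = c1 w"
    "c1 u = a" "c1 m = d" "card {z. (z, u) \<in> A1} = x" "card {z. (z, m) \<in> A1} = y"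
    by (rule profilesE)
    note A1 = A1[rule_format] and c1 = c1[rule_format]
  from 2 obtain A2 c2 where A2: "A2 \<subseteq> R2" "\<forall>p q. (p, q) \<in> R2 \<longrightarrow> ((p, q) \<in> A2 \<longleftrightarrow> (q, p) \<notin> A2)"
    and c2: "\<forall>p q. (p, q) \<in> R2 \<longrightarrow> c2 p \<noteq> c2 q" "\<forall>w. w \<in> V2 \<longrightarrow> c2 w \<le> 3"
    "\<forall>w. w \<in> V2 \<longrightarrow> w \<noteq> m \<longrightarrow> w \<noteq> v \<longrightarrow> card {z. (z, w) \<in> A2} = c2 w"
    "c2 m = d" "c2 v = b" "card {z. (z, m) \<in> A2} = y'" "card {z. (z, v) \<in> A2} = z"
    by (rule profilesE)
    note A2 = A2[rule_format] and c2 = c2[rule_format]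
  define c where "c w = (if w \<in> V1 then c1 w else c2 w)" for w
  have cV1: "c w = c1 w" if "w \<in> V1" for w using that by (simp add: c_def)
  have cV2: "c w = c2 w" if "w \<in> V2" for w
    using that V(1) c1(5) c2(4) by (cases "w = m") (auto simp: c_def)
  have in1: "{z. (z, w) \<in> A1 \<union> A2} = {z. (z, w) \<in> A1}" if "w \<in> V1" "w \<noteq> m" for w
    using that A2(1) R2 V(1) by auto
  have in2: "{z. (z, w) \<in> A1 \<union> A2} = {z. (z, w) \<in> A2}" if "w \<in> V2" "w \<noteq> m" for w
    using that A1(1) R1 V(1) by auto
  have irr: "(p, p) \<notin> R1" "(p, p) \<notin> R2" for p using A1(2)[of p p] A2(2)[of p p] by auto
  have dis: "(p, q) \<notin> R1 \<or> (p, q) \<notin> R2" "(q, p) \<notin> R1 \<or> (p, q) \<notin> R2" for p q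
  proof -
    have "p = m \<and> q = m" if "p \<in> V1" "q \<in> V1" "p \<in> V2" "q \<in> V2" using that V(1) by auto
    then show "(p, q) \<notin> R1 \<or> (p, q) \<notin> R2" "(q, p) \<notin> R1 \<or> (p, q) \<notin> R2"
      using R1 R2 irr by auto
  qed
  have inm: "card {z. (z, m) \<in> A1 \<union> A2} = d"
  proof -
    have "{z. (z, m) \<in> A1 \<union> A2} = {z. (z, m) \<in> A1} \<union> {z. (z, m) \<in> A2}" by auto
    moreover have "{z. (z, m) \<in> A1} \<inter> {z. (z, m) \<in> A2} = {}"
      using A1(1) A2(1) dis by auto
    moreover have "finite {z. (z, m) \<in> A1}"
      by (rule finite_subset[OF _ fin(1)]) (use A1(1) R1 in auto)
    moreover have "finite {z. (z, m) \<in> A2}"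
      by (rule finite_subset[OF _ fin(2)]) (use A2(1) R2 in auto)
    ultimately show ?thesis using d c1(7) c2(6) by (simp add: card_Un_disjoint)
  qed
  show "(a, b, x, z) \<in> profiles (V1 \<union> V2) (R1 \<union> R2) u v"
  proof (rule profilesI[where A = "A1 \<union> A2" and c = c])
    show "A1 \<union> A2 \<subseteq> R1 \<union> R2" using A1(1) A2(1) by blast
    fix p q assume pq: "(p, q) \<in> R1 \<union> R2"
    then show "c p \<noteq> c q"
    proof
      assume "(p, q) \<in> R1"
      then show ?thesis using c1(1)[of p q] cV1 R1 by auto
    next
      assume "(p, q) \<in> R2"
      then show ?thesis using c2(1)[of p q] cV2 R2 by auto
    qed
    show "(p, q) \<in> A1 \<union> A2 \<longleftrightarrow> (q, p) \<notin> A1 \<union> A2"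
    proof (cases "(p, q) \<in> R1")
      case True
      have "(p, q) \<notin> R2" "(q, p) \<notin> R2" using True dis by blast+
      then show ?thesis using A1(2)[OF True] A2(1) by blast
    next
      case False
      then have "(p, q) \<in> R2" using pq by blast
      moreover from this have "(p, q) \<notin> R1" "(q, p) \<notin> R1" using dis by blast+
      ultimately show ?thesis using A2(2)[of p q] A1(1) by blast
    qed
  next
    fix w assume w: "w \<in> V1 \<union> V2"
    then show "c w \<le> 3" using c1(2)[of w] c2(2)[of w] cV1 cV2 by auto
    assume "w \<noteq> u" "w \<noteq> v"
    show "card {z. (z, w) \<in> A1 \<union> A2} = c w"
    proof (cases "w = m")
      case True
      moreover have "m \<in> V1" using V(1) by blast
      ultimately show ?thesis using inm c1(5) cV1 by simp
    next
      case False
      from w show ?thesis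
      proof
        assume "w \<in> V1"
        then show ?thesis using in1 c1(3) cV1 False \<open>w \<noteq> u\<close> by simp
      next
        assume "w \<in> V2"
        then show ?thesis using in2 c2(3) cV2 False \<open>w \<noteq> v\<close> by simp
      qed
    qed
  next
    show "c u = a" "c v = b" using c1(4) c2(5) cV1 cV2 V by auto
    show "card {z. (z, u) \<in> A1 \<union> A2} = x" using in1 V c1(6) by simp
    show "card {z. (z, v) \<in> A1 \<union> A2} = z" using in2 V c2(7) by simp
  qed
qed

lemma add_edge_profiles:
  assumes fin: "finite V" and R: "R \<subseteq> V \<times> V"
    and uv: "u \<in> V" "v \<in> V" "u \<noteq> v" "(u, v) \<notin> R" "(v, u) \<notin> R"
  shows "add_edge (profiles V R u v) \<subseteq> profiles V (R \<union> {(u, v), (v, u)}) u v"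
proof clarify
  fix a b x y assume abxy: "(a, b, x, y) \<in> add_edge (profiles V R u v)"
  have fin': "finite {z. (z, w) \<in> A}" if "A \<subseteq> R" for A w
    by (rule finite_subset[OF _ fin]) (use that R in auto)
  have ab: "a \<noteq> b" using abxy by (simp add: add_edge_def)
  consider "0 < x" "(a, b, x - 1, y) \<in> profiles V R u v"
    | "0 < y" "(a, b, x, y - 1) \<in> profiles V R u v"
    using abxy by (auto simp: add_edge_def)
  then show "(a, b, x, y) \<in> profiles V (R \<union> {(u, v), (v, u)}) u v"
  proof cases
    case 1
    from 1(2) obtain A c where A: "A \<subseteq> R" "\<forall>p q. (p, q) \<in> R \<longrightarrow> ((p, q) \<in> A \<longleftrightarrow> (q, p) \<notin> A)"
      and c: "\<forall>p q. (p, q) \<in> R \<longrightarrow> c p \<noteq> c q" "\<forall>w. w \<in> V \<longrightarrow> c w \<le> 3"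
      "\<forall>w. w \<in> V \<longrightarrow> w \<noteq> u \<longrightarrow> w \<noteq> v \<longrightarrow> card {z. (z, w) \<in> A} = c w"
      "c u = a" "c v = b" "card {z. (z, u) \<in> A} = x - 1" "card {z. (z, v) \<in> A} = y"
      by (rule profilesE)
    note A = A[rule_format] and c = c[rule_format]
    have ins: "{z. (z, u) \<in> insert (v, u) A} = insert v {z. (z, u) \<in> A}" by auto
    have deg: "card {z. (z, u) \<in> insert (v, u) A} = x"
      using fin'[OF A(1)] c(6,7) 1(1) uv A(1) by (subst ins) (auto simp: card_insert_if)
    have other: "{z. (z, w) \<in> insert (v, u) A} = {z. (z, w) \<in> A}" if "w \<noteq> u" for w
      using that by auto
    show ?thesis
    proof (rule profilesI[where A = "insert (v, u) A" and c = c])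
      fix s t assume st: "(s, t) \<in> R \<union> {(u, v), (v, u)}"
      show "(s, t) \<in> insert (v, u) A \<longleftrightarrow> (t, s) \<notin> insert (v, u) A"
      proof (cases "(s, t) \<in> R")
        case True
        then show ?thesis using A(2)[OF True] uv(4,5) A(1) by blast
      qed (use st uv A(1) in auto)
      show "c s \<noteq> c t" using st c(1,4,5) ab by auto
    qed (use A(1) c(2-7) deg other uv in auto)
  next
    case 2
    from 2(2) obtain A c where A: "A \<subseteq> R" "\<forall>p q. (p, q) \<in> R \<longrightarrow> ((p, q) \<in> A \<longleftrightarrow> (q, p) \<notin> A)"
      and c: "\<forall>p q. (p, q) \<in> R \<longrightarrow> c p \<noteq> c q" "\<forall>w. w \<in> V \<longrightarrow> c w \<le> 3"
      "\<forall>w. w \<in> V \<longrightarrow> w \<noteq> u \<longrightarrow> w \<noteq> v \<longrightarrow> card {z. (z, w) \<in> A} = c w"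
      "c u = a" "c v = b" "card {z. (z, u) \<in> A} = x" "card {z. (z, v) \<in> A} = y - 1"
      by (rule profilesE)
    note A = A[rule_format] and c = c[rule_format]
    have ins: "{z. (z, v) \<in> insert (u, v) A} = insert u {z. (z, v) \<in> A}" by auto
    have deg: "card {z. (z, v) \<in> insert (u, v) A} = y"
      using fin'[OF A(1)] c(6,7) 2(1) uv A(1) by (subst ins) (auto simp: card_insert_if)
    have other: "{z. (z, w) \<in> insert (u, v) A} = {z. (z, w) \<in> A}" if "w \<noteq> v" for w
      using that by auto
    show ?thesis
    proof (rule profilesI[where A = "insert (u, v) A" and c = c])
      fix s t assume st: "(s, t) \<in> R \<union> {(u, v), (v, u)}"
      show "(s, t) \<in> insert (u, v) A \<longleftrightarrow> (t, s) \<notin> insert (u, v) A"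
      proof (cases "(s, t) \<in> R")
        case True
        then show ?thesis using A(2)[OF True] uv(4,5) A(1) by blast
      qed (use st uv A(1) in auto)
      show "c s \<noteq> c t" using st c(1,4,5) ab by auto
    qed (use A(1) c(2-7) deg other uv in auto)
  qed
qed

lemma free_profiles_edge:
  assumes "u \<noteq> v"
  shows "set free_profiles \<subseteq> profiles {u, v} {} u v"
proof
  fix t assume "t \<in> set free_profiles"
  then obtain a b where t: "t = (a, b, 0, 0)" "a \<le> 3" "b \<le> 3"
    by (auto simp: free_profiles_def)
  show "t \<in> profiles {u, v} {} u v"
    unfolding t(1) using assms t(2,3)
    by (intro profilesI[where A = "{}" and c = "\<lambda>w. if w = u then a else b"]) auto
qed

lemma polygon_chain:
  fixes E :: "nat rel"
  assumes E: "sym E" "irrefl E" and path: "\<And>i. Suc i < n \<Longrightarrow> (i, Suc i) \<in> E"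
    and cross: "\<And>i k j l. i < k \<Longrightarrow> k < j \<Longrightarrow> j < l \<Longrightarrow> l < n \<Longrightarrow> (i, j) \<in> E \<Longrightarrow> (k, l) \<notin> E"
    and tri: "\<And>x y z. (x, y) \<in> E \<Longrightarrow> (y, z) \<in> E \<Longrightarrow> (z, x) \<notin> E"
    and ij: "i < j" "j < n"
  defines "F \<equiv> \<lambda>i j. E \<inter> {i..j} \<times> {i..j}"
  defines "H \<equiv> \<lambda>i j. F i j - {(i, j), (j, i)}"
  shows "((i, j) \<in> E \<longrightarrow> flexible (profiles {i..j} (H i j) i j)) \<and>
    (\<exists>k \<ge> 1. ((i, j) \<notin> E \<longrightarrow> k \<ge> 2) \<and> chain k (profiles {i..j} (F i j) i j))"
  using ij
proof (induction "j - i" arbitrary: i j rule: less_induct)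
  case less
  have sy: "(x, y) \<in> E \<longleftrightarrow> (y, x) \<in> E" for x y using E(1) by (auto simp: sym_def)
  have irr: "(x, x) \<notin> E" for x using E(2) by (auto simp: irrefl_def)
  have FH: "add_edge (profiles {i..j} (H i j) i j) \<subseteq> profiles {i..j} (F i j) i j"
    if "i < j" "(i, j) \<in> E" for i j
  proof -
    have "F i j = H i j \<union> {(i, j), (j, i)}" using that sy by (auto simp: H_def F_def)
    then show ?thesis
      using add_edge_profiles[of "{i..j}" "H i j" i j] that by (auto simp: H_def F_def)
  qed
  have single: "\<exists>k \<ge> 1. ((i, j) \<notin> E \<longrightarrow> k \<ge> 2) \<and> chain k (profiles {i..j} (F i j) i j)"
    if "(i, j) \<in> E" "flexible (profiles {i..j} (H i j) i j)"
    using chain.single[OF that(2) FH[OF less.prems(1) that(1)]] that(1) by blast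
  show ?case
  proof (cases "j = Suc i")
    case True
    have 1: "(i, j) \<in> E" using path True less.prems by simp
    have "H i j = {}" using irr by (auto simp: H_def F_def True le_Suc_eq)
    moreover have "{i..j} = {i, j}" using True by auto
    ultimately have "flexible (profiles {i..j} (H i j) i j)"
      using free_profiles_edge[of i j] less.prems(1) by (simp add: flexible_def)
    then show ?thesis using 1 single by blast
  next
    case False
    define M where "M = {m. i < m \<and> m < j \<and> (i, m) \<in> E}"
    have "Suc i \<in> M" using path False less.prems by (auto simp: M_def)
    moreover have fM: "finite M" by (simp add: M_def)
    ultimately have "Max M \<in> M" by (intro Max_in) auto
    then obtain m where m: "i < m" "m < j" "(i, m) \<in> E" and max: "\<And>t. t \<in> M \<Longrightarrow> t \<le> m"
      using fM by (auto simp: M_def)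
    have H: "H i j = F i m \<union> F m j"
    proof -
      have "(s, t) \<in> F i m \<union> F m j" if "(s, t) \<in> H i j" "s < t" for s t
      proof (cases "t \<le> m \<or> m \<le> s")
        case False
        have "t \<notin> M" using max[of t] False by auto
        then have "s \<noteq> i" using that by (auto simp: H_def F_def M_def)
        then have "i < s" using that by (auto simp: H_def F_def)
        then show ?thesis
          using cross[of i s m t] False that m(3) less.prems by (auto simp: H_def F_def)
      qed (use that m in \<open>auto simp: H_def F_def\<close>)
      moreover have "(s, t) \<in> F i m \<union> F m j \<longleftrightarrow> (t, s) \<in> F i m \<union> F m j"
        "(s, t) \<in> H i j \<longleftrightarrow> (t, s) \<in> H i j" for s t
        using sy by (auto simp: H_def F_def)
      moreover have "(s, s) \<notin> H i j" for s using irr by (auto simp: H_def F_def)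
      ultimately have "H i j \<subseteq> F i m \<union> F m j"
        by (intro subrelI) (metis linorder_neqE_nat)
      moreover have "F i m \<union> F m j \<subseteq> H i j" using m by (auto simp: H_def F_def)
      ultimately show ?thesis by blast
    qed
    have lt: "m - i < j - i" "j - m < j - i" using m by arith+
    have P: "flexible (profiles {i..m} (H i m) i m)"
      using less.hyps[OF lt(1) m(1)] m less.prems by auto
    obtain k where k: "k \<ge> 1" "(m, j) \<notin> E \<Longrightarrow> k \<ge> 2" "chain k (profiles {m..j} (F m j) m j)"
      using less.hyps[OF lt(2) m(2) less.prems(2)] by blast
    have "glue (profiles {i..m} (F i m) i m) (profiles {m..j} (F m j) m j)
        \<subseteq> profiles ({i..m} \<union> {m..j}) (F i m \<union> F m j) i j"
      using m by (intro glue_profiles) (auto simp: F_def)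
    moreover have "{i..m} \<union> {m..j} = {i..j}" using m by auto
    ultimately have "glue (profiles {i..m} (F i m) i m) (profiles {m..j} (F m j) m j)
        \<subseteq> profiles {i..j} (H i j) i j"
      by (simp add: H)
    then have "glue (add_edge (profiles {i..m} (H i m) i m)) (profiles {m..j} (F m j) m j)
        \<subseteq> profiles {i..j} (H i j) i j"
      using glue_mono[OF FH[OF m(1,3)] order_refl] by blast
    from chain.cons[OF P k(3) this] have ch: "chain (Suc k) (profiles {i..j} (H i j) i j)" .
    show ?thesis
    proof (cases "(i, j) \<in> E")
      case True
      then have "(m, j) \<notin> E" using tri m(3) sy by blast
      then have "flexible (profiles {i..j} (H i j) i j)" using chain_flexible[OF ch] k(2) by simp
      then show ?thesis using True single by blast
    next
      case False
      then have "H i j = F i j" using sy by (auto simp: H_def F_def)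
      then show ?thesis using ch k(1) False by (intro conjI exI[of _ "Suc k"]) auto
    qed
  qed
qed

lemma polygon_proper_orientation:
  fixes E :: "nat rel"
  assumes E: "sym E" "irrefl E" "E \<subseteq> {..<n} \<times> {..<n}"
    and path: "\<And>i. Suc i < n \<Longrightarrow> (i, Suc i) \<in> E" and close: "(n - 1, 0) \<in> E"
    and cross: "\<And>i k j l. i < k \<Longrightarrow> k < j \<Longrightarrow> j < l \<Longrightarrow> l < n \<Longrightarrow> (i, j) \<in> E \<Longrightarrow> (k, l) \<notin> E"
    and tri: "\<And>x y z. (x, y) \<in> E \<Longrightarrow> (y, z) \<in> E \<Longrightarrow> (z, x) \<notin> E"
  obtains A where "A \<subseteq> E" "\<And>p q. (p, q) \<in> E \<Longrightarrow> (p, q) \<in> A \<longleftrightarrow> (q, p) \<notin> A"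
    "\<And>p q. (p, q) \<in> E \<Longrightarrow> card {z. (z, p) \<in> A} \<noteq> card {z. (z, q) \<in> A}"
    "\<And>p. p < n \<Longrightarrow> card {z. (z, p) \<in> A} \<le> 3"
proof -
  let ?H = "E - {(0, n - 1), (n - 1, 0)}"
  have n: "0 < n - 1" using close E(2) by (cases "n - 1 = 0") (auto simp: irrefl_def)
  have V: "{0..n - 1} = {..<n}" using n by auto
  have F: "E \<inter> {0..n - 1} \<times> {0..n - 1} = E" unfolding V using E(3) by auto
  have c: "(0, n - 1) \<in> E" using close E(1) by (auto simp: sym_def)
  have "flexible (profiles {0..n - 1} ?H 0 (n - 1))"
    using polygon_chain[OF E(1,2) path cross tri n] n c unfolding F by auto
  moreover have "(0, 1, 0, 0) \<in> set free_profiles" "(0, 1, 0, 0) \<in> set pentagon_profiles"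
    by (auto simp: free_profiles_def pentagon_profiles_def)
  ultimately have "(0, 1, 0, 0) \<in> profiles {0..n - 1} ?H 0 (n - 1)" unfolding flexible_def by blast
  then have "(0, 1, 0, 1) \<in> add_edge (profiles {0..n - 1} ?H 0 (n - 1))" by (simp add: add_edge_def)
  moreover have "add_edge (profiles {0..n - 1} ?H 0 (n - 1))
      \<subseteq> profiles {0..n - 1} (?H \<union> {(0, n - 1), (n - 1, 0)}) 0 (n - 1)"
    using n E(3) unfolding V by (intro add_edge_profiles) auto
  moreover have "?H \<union> {(0, n - 1), (n - 1, 0)} = E" using c close by auto
  ultimately have "(0, 1, 0, 1) \<in> profiles {..<n} E 0 (n - 1)" unfolding V by auto
  then obtain A c where A: "A \<subseteq> E" "\<forall>p q. (p, q) \<in> E \<longrightarrow> ((p, q) \<in> A \<longleftrightarrow> (q, p) \<notin> A)"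
    and c: "\<forall>p q. (p, q) \<in> E \<longrightarrow> c p \<noteq> c q" "\<forall>w. w \<in> {..<n} \<longrightarrow> c w \<le> 3"
    "\<forall>w. w \<in> {..<n} \<longrightarrow> w \<noteq> 0 \<longrightarrow> w \<noteq> n - 1 \<longrightarrow> card {z. (z, w) \<in> A} = c w"
    "c 0 = 0" "c (n - 1) = 1" "card {z. (z, 0) \<in> A} = 0" "card {z. (z, n - 1) \<in> A} = 1"
    by (rule profilesE)
    note A = A[rule_format] and c = c[rule_format]
  have deg: "card {z. (z, p) \<in> A} = c p" if "p < n" for p
    using c(3)[of p] c(4-7) that by (cases "p = 0"; cases "p = n - 1") auto
  show thesis
  proof (rule that[OF A])
    fix p q assume "(p, q) \<in> E"
    then show "card {z. (z, p) \<in> A} \<noteq> card {z. (z, q) \<in> A}"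
      using deg c(1) E(3) by (metis lessThan_iff mem_Sigma_iff subsetD)
  qed (use deg c(2) in auto)
qed

section \<open>Theta curves in the plane\<close>

lemma Jordan_sides:
  fixes c :: "real \<Rightarrow> complex"
  assumes c: "simple_path c" "pathfinish c = pathstart c"
    and F: "Topological_Spaces.connected F" "F \<inter> path_image c = {}"
  obtains U W where "F \<subseteq> U" "Topological_Spaces.connected U" "open U" "Topological_Spaces.connected W" "open W" "W \<noteq> {}"
    "U \<inter> W = {}" "U \<union> W = - path_image c" "frontier U = path_image c" "frontier W = path_image c"
proof -
  let ?I = "inside (path_image c)" and ?O = "outside (path_image c)"
  note J = Jordan_inside_outside[OF c]
  have "F \<subseteq> ?I \<union> ?O" using F(2) J by blast
  then have "F \<subseteq> ?I \<or> F \<subseteq> ?O"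
    using connectedD[OF F(1), of ?I ?O] J by blast
  then show thesis
  proof
    assume "F \<subseteq> ?I"
    then show thesis using J by (intro that[of ?I ?O]) auto
  next
    assume "F \<subseteq> ?O"
    then show thesis using J by (intro that[of ?O ?I]) (simp_all add: Un_commute Int_commute)
  qed
qed

lemma arc_join_cycle:
  assumes "arc c1" "pathstart c1 = a" "pathfinish c1 = b"
    and "arc c2" "pathstart c2 = a" "pathfinish c2 = b"
    and "path_image c1 \<inter> path_image c2 = {a, b}"
  shows "simple_path (c1 +++ reversepath c2)"
    and "pathfinish (c1 +++ reversepath c2) = pathstart (c1 +++ reversepath c2)"
    and "path_image (c1 +++ reversepath c2) = path_image c1 \<union> path_image c2"
proof -
  show "simple_path (c1 +++ reversepath c2)"
    using assms by (intro simple_path_join_loop) (auto simp: arc_reversepath)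
qed (use assms in \<open>auto simp: path_image_join\<close>)

text \<open>
  If \<open>W\<close> is the side of the cycle \<open>c1 \<union> c2\<close> not containing \<open>F\<close>, then \<open>W\<close> lies on the same
  side as \<open>F\<close> of the two other cycles, so by Janiszewski's theorem the whole theta curve does not
  separate \<open>W\<close> from \<open>F\<close>, although \<open>c1 \<union> c2\<close> does.
\<close>

lemma theta_curve_face:
  fixes c1 c2 c3 :: "real \<Rightarrow> complex"
  assumes c1: "arc c1" "pathstart c1 = a" "pathfinish c1 = b"
    and c2: "arc c2" "pathstart c2 = a" "pathfinish c2 = b"
    and c3: "arc c3" "pathstart c3 = a" "pathfinish c3 = b"
    and c12: "path_image c1 \<inter> path_image c2 = {a, b}"
    and c13: "path_image c1 \<inter> path_image c3 = {a, b}"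
    and c23: "path_image c2 \<inter> path_image c3 = {a, b}"
    and F: "Topological_Spaces.connected F" "F \<inter> (path_image c1 \<union> path_image c2 \<union> path_image c3) = {}"
    and x1: "x1 \<in> path_image c1 - {a, b}" "x1 \<in> closure F"
    and x2: "x2 \<in> path_image c2 - {a, b}" "x2 \<in> closure F"
    and x3: "x3 \<in> path_image c3 - {a, b}" "x3 \<in> closure F"
  shows False
proof -
  have side: "\<exists>U W. F \<subseteq> U \<and> Topological_Spaces.connected U \<and> open U \<and> Topological_Spaces.connected W \<and> open W \<and> W \<noteq> {} \<and>
      U \<inter> W = {} \<and> U \<union> W = - (path_image p \<union> path_image q) \<and>
      frontier U = path_image p \<union> path_image q \<and> frontier W = path_image p \<union> path_image q"
    if "arc p" "pathstart p = a" "pathfinish p = b" "arc q" "pathstart q = a" "pathfinish q = b"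
      "path_image p \<inter> path_image q = {a, b}" "F \<inter> (path_image p \<union> path_image q) = {}" for p q
    using Jordan_sides[OF arc_join_cycle(1,2)[OF that(1-7)] F(1)]
    unfolding arc_join_cycle(3)[OF that(1-7)] using that(8) by metis
  obtain U3 W3 where 3: "F \<subseteq> U3" "open U3" "Topological_Spaces.connected W3" "W3 \<noteq> {}" "open W3"
      "U3 \<inter> W3 = {}" "U3 \<union> W3 = - (path_image c1 \<union> path_image c2)"
      "frontier U3 = path_image c1 \<union> path_image c2" "frontier W3 = path_image c1 \<union> path_image c2"
    using side[OF c1 c2 c12] F(2) by blast
  obtain U2 W2 where 2: "F \<subseteq> U2" "open U2" "Topological_Spaces.connected U2" "open W2" "U2 \<inter> W2 = {}"
      "U2 \<union> W2 = - (path_image c1 \<union> path_image c3)" "frontier U2 = path_image c1 \<union> path_image c3"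
    using side[OF c1 c3 c13] F(2) by blast
  obtain U1 W1 where 1: "F \<subseteq> U1" "open U1" "Topological_Spaces.connected U1" "open W1" "U1 \<inter> W1 = {}"
      "U1 \<union> W1 = - (path_image c2 \<union> path_image c3)" "frontier U1 = path_image c2 \<union> path_image c3"
    using side[OF c2 c3 c23] F(2) by blast
  have cl: "x \<in> U" if "x \<in> closure F" "F \<subseteq> U" "frontier U = J" "x \<notin> J" for x U J
    using that closure_mono[OF that(2)] closure_Un_frontier[of U] by auto
  have in3: "x3 \<in> U3" using cl[OF x3(2) 3(1) 3(8)] x3(1) c13 c23 by blast
  have in2: "x2 \<in> U2" using cl[OF x2(2) 2(1) 2(7)] x2(1) c12 c23 by blast
  have in1: "x1 \<in> U1" using cl[OF x1(2) 1(1) 1(7)] x1(1) c12 c13 by blast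
  have W3: "W3 \<inter> path_image c3 = {}"
  proof -
    have con: "Topological_Spaces.connected (path_image c3 - {a, b})"
      using connected_simple_path_endless[OF arc_imp_simple_path[OF c3(1)]] c3 by simp
    have sub: "path_image c3 - {a, b} \<subseteq> U3 \<union> W3" unfolding 3(7) using c13 c23 by blast
    have "W3 \<inter> (path_image c3 - {a, b}) = {}"
      using connectedD[OF con, of U3 W3] 3(2,5,6) in3 x3(1) sub by blast
    moreover have "a \<notin> W3" "b \<notin> W3" using 3(7) c12 by blast+
    ultimately show ?thesis by blast
  qed
  have meet: "W3 \<subseteq> U" if "x \<in> U" "x \<in> path_image c1 \<union> path_image c2" "open U" "open W" "U \<inter> W = {}"
      "W3 \<subseteq> U \<union> W" for x U W
  proof -
    have "x \<in> closure W3" using that(2) 3(9) unfolding frontier_def by blast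
    then have "U \<inter> W3 \<noteq> {}" using that(1,3) open_Int_closure_eq_empty by blast
    then show ?thesis using connectedD[OF 3(3), of U W] that by blast
  qed
  have s2: "W3 \<subseteq> U2"
    by (rule meet[OF in2 _ 2(2,4,5)]) (use x2(1) 2(6) W3 3(7) in auto)
  have s1: "W3 \<subseteq> U1"
    by (rule meet[OF in1 _ 1(2,4,5)]) (use x1(1) 1(6) W3 3(7) in auto)
  obtain p where p: "p \<in> W3" using 3(4) by blast
  obtain q where q: "q \<in> F" using x1(2) by fastforce
  have "connected_component (- (path_image c1 \<union> path_image c3)) p q"
    unfolding connected_component_def using 2 s2 p q by blast
  moreover have "connected_component (- (path_image c2 \<union> path_image c3)) p q"
    unfolding connected_component_def using 1 s1 p q by blast
  moreover have "(path_image c1 \<union> path_image c3) \<inter> (path_image c2 \<union> path_image c3) = path_image c3"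
    using c12 c13 c23 by auto
  ultimately have "connected_component (- ((path_image c1 \<union> path_image c3) \<union>
      (path_image c2 \<union> path_image c3))) p q"
    using c1(1) c2(1) c3(1) Janiszewski[of "path_image c1 \<union> path_image c3"
        "path_image c2 \<union> path_image c3" p q]
    by (simp only: compact_Un compact_arc_image closed_arc_image closed_Un connected_arc_image)
  then have "connected_component (- (path_image c1 \<union> path_image c2)) p q"
    by (rule connected_component_of_subset) blast
  then obtain T where T: "Topological_Spaces.connected T" "T \<subseteq> - (path_image c1 \<union> path_image c2)" "p \<in> T" "q \<in> T"
    unfolding connected_component_def by blast
  show False
    using connectedD[OF T(1) 3(2,5)] T(2-4) 3(1,6,7) p q by blast
qed

definition vertex_path :: "'a rel \<Rightarrow> 'a list \<Rightarrow> bool" where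
  "vertex_path R xs \<longleftrightarrow> distinct xs \<and> successively (\<lambda>x y. (x, y) \<in> R) xs"

definition theta_free :: "'a rel \<Rightarrow> bool" where
  "theta_free R \<longleftrightarrow> \<not> (\<exists>u v p q r. p \<noteq> [] \<and> q \<noteq> [] \<and> r \<noteq> [] \<and>
     set p \<inter> set q = {} \<and> set p \<inter> set r = {} \<and> set q \<inter> set r = {} \<and>
     vertex_path R (u # p @ [v]) \<and> vertex_path R (u # q @ [v]) \<and> vertex_path R (u # r @ [v]))"

lemma zip_tl_mem:
  assumes "(x, y) \<in> set (zip xs (tl xs))"
  shows "x \<in> set xs" "y \<in> set xs"
  using assms by (auto dest: set_zip_leftD set_zip_rightD list.set_sel(2)[rotated])
    (metis list.sel(2) list.set_sel(2) set_zip_rightD)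

lemma zip_tl_rel:
  assumes "vertex_path R xs" "(x, y) \<in> set (zip xs (tl xs))"
  shows "(x, y) \<in> R"
  using assms by (auto simp: vertex_path_def set_zip successively_conv_nth nth_tl)

lemma zip_tl_inner:
  assumes "distinct (u # p @ [v])" "p \<noteq> []" "(x, y) \<in> set (zip (u # p @ [v]) (p @ [v]))"
  shows "x \<in> set p \<or> y \<in> set p"
proof -
  obtain i where i: "i < length (p @ [v])" "x = (u # p @ [v]) ! i" "y = (p @ [v]) ! i"
    using assms(3) by (auto simp: set_zip)
  show ?thesis
  proof (cases "i < length p")
    case True
    then show ?thesis using i by (auto simp: nth_append)
  next
    case False
    then have "i = length p" using i by simp
    then show ?thesis using i assms(2) by (auto simp: nth_Cons' nth_append)
  qed
qed

lemma plane_embedding_edges_meet: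
  assumes "plane_embedding G p c" "(u, v) \<in> parcs G" "(x, y) \<in> parcs G" "{u, v} \<noteq> {x, y}"
    and wf: "parcs G \<subseteq> pverts G \<times> pverts G"
  shows "path_image (c (u, v)) \<inter> path_image (c (x, y)) \<subseteq> p ` ({u, v} \<inter> {x, y})"
proof
  fix z assume z: "z \<in> path_image (c (u, v)) \<inter> path_image (c (x, y))"
  have e: "path_image (c (s, t)) \<inter> p ` pverts G = {p s, p t}" if "(s, t) \<in> parcs G" for s t
    using assms(1) that unfolding plane_embedding_def by fast
  have "z \<in> p ` pverts G"
    using assms(1-4) z unfolding plane_embedding_def by blast
  then obtain w where w: "w \<in> pverts G" "z = p w" by blast
  have "p w \<in> {p u, p v}" "p w \<in> {p x, p y}" using e[OF assms(2)] e[OF assms(3)] w z by blast+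
  moreover have "inj_on p (pverts G)" using assms(1) unfolding plane_embedding_def by blast
  ultimately have "w \<in> {u, v} \<inter> {x, y}"
    using w(1) assms(2,3) wf by (auto simp: inj_on_eq_iff subset_iff)
  then show "z \<in> p ` ({u, v} \<inter> {x, y})" using w by blast
qed

lemma plane_embedding_path_arc:
  assumes "plane_embedding G p c" "vertex_path (parcs G) xs" "length xs \<ge> 2"
    and wf: "parcs G \<subseteq> pverts G \<times> pverts G"
  shows "\<exists>g. arc g \<and> pathstart g = p (hd xs) \<and> pathfinish g = p (last xs) \<and>
           path_image g = (\<Union>e \<in> set (zip xs (tl xs)). path_image (c e))"
  using assms(2,3)
proof (induction xs)
  case (Cons u xs)
  then obtain v ws where xs: "xs = v # ws" by (cases xs) auto
  have uv: "(u, v) \<in> parcs G" using Cons.prems by (auto simp: xs vertex_path_def)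
  have c: "arc (c (u, v))" "pathstart (c (u, v)) = p u" "pathfinish (c (u, v)) = p v"
    using assms(1) uv unfolding plane_embedding_def by fast+
  show ?case
  proof (cases ws)
    case Nil
    then show ?thesis using c by (auto simp: xs)
  next
    case (Cons w ws')
    have path: "vertex_path (parcs G) xs"
      using Cons.prems by (auto simp: xs Cons vertex_path_def)
    then obtain g where g: "arc g" "pathstart g = p v" "pathfinish g = p (last xs)"
        "path_image g = (\<Union>e \<in> set (zip xs (tl xs)). path_image (c e))"
      using Cons.IH by (auto simp: xs Cons)
    have "path_image (c (u, v)) \<inter> path_image (c (x, y)) \<subseteq> {p v}"
      if "(x, y) \<in> set (zip xs (tl xs))" for x y
    proof -
      have "u \<notin> {x, y}" using zip_tl_mem[OF that] Cons.prems(1) by (auto simp: vertex_path_def)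
      then show ?thesis
        using plane_embedding_edges_meet[OF assms(1) uv zip_tl_rel[OF path that] _ wf] by auto
    qed
    then have "path_image (c (u, v)) \<inter> path_image g \<subseteq> {p v}" unfolding g(4) by fast
    then have "arc (c (u, v) +++ g)" using c g by (intro arc_join) auto
    then show ?thesis
      using c g by (intro exI[of _ "c (u, v) +++ g"]) (auto simp: path_image_join xs)
  qed
qed simp

lemma outerplanar_theta_free:
  assumes "outerplanar G" and wf: "parcs G \<subseteq> pverts G \<times> pverts G"
  shows "theta_free (parcs G)"
  unfolding theta_free_def
proof clarify
  fix u v r1 r2 r3
  assume ne: "r1 \<noteq> []" "r2 \<noteq> []" "r3 \<noteq> []"
    and dis: "set r1 \<inter> set r2 = {}" "set r1 \<inter> set r3 = {}" "set r2 \<inter> set r3 = {}"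
    and path: "vertex_path (parcs G) (u # r1 @ [v])" "vertex_path (parcs G) (u # r2 @ [v])"
      "vertex_path (parcs G) (u # r3 @ [v])"
  obtain p c F where emb: "plane_embedding G p c" and F: "F \<in> faces G p c" "p ` pverts G \<subseteq> frontier F"
    using assms(1) unfolding outerplanar_def by blast
  define im where "im r = (\<Union>e \<in> set (zip (u # r @ [v]) (r @ [v])). path_image (c e))" for r
  have inj: "inj_on p (pverts G)" using emb unfolding plane_embedding_def by blast
  have arcs: "\<exists>g. arc g \<and> pathstart g = p u \<and> pathfinish g = p v \<and> path_image g = im r"
    if "vertex_path (parcs G) (u # r @ [v])" for r
    using plane_embedding_path_arc[OF emb that _ wf] by (auto simp: im_def)
  obtain g1 where g1: "arc g1" "pathstart g1 = p u" "pathfinish g1 = p v" "path_image g1 = im r1"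
    using arcs[OF path(1)] by blast
  obtain g2 where g2: "arc g2" "pathstart g2 = p u" "pathfinish g2 = p v" "path_image g2 = im r2"
    using arcs[OF path(2)] by blast
  obtain g3 where g3: "arc g3" "pathstart g3 = p u" "pathfinish g3 = p v" "path_image g3 = im r3"
    using arcs[OF path(3)] by blast
  have meet: "im r \<inter> im s \<subseteq> {p u, p v}"
    if r: "vertex_path (parcs G) (u # r @ [v])" "r \<noteq> []" and s: "vertex_path (parcs G) (u # s @ [v])" "s \<noteq> []"
      and d: "set r \<inter> set s = {}" for r s
  proof
    fix z assume "z \<in> im r \<inter> im s"
    then obtain a b x y where ab: "(a, b) \<in> set (zip (u # r @ [v]) (r @ [v]))" "z \<in> path_image (c (a, b))"
      and xy: "(x, y) \<in> set (zip (u # s @ [v]) (s @ [v]))" "z \<in> path_image (c (x, y))"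
      unfolding im_def by fast
    have mem: "{a, b} \<subseteq> set (u # r @ [v])" "{x, y} \<subseteq> set (u # s @ [v])"
      using zip_tl_mem[of a b "u # r @ [v]"] zip_tl_mem[of x y "u # s @ [v]"] ab(1) xy(1) by simp_all
    have "a \<in> set r \<or> b \<in> set r"
      using zip_tl_inner[of u r v a b] r ab by (auto simp: vertex_path_def)
    then have "{a, b} \<noteq> {x, y}"
      using mem d r(1) by (auto simp: vertex_path_def doubleton_eq_iff)
    moreover have "(a, b) \<in> parcs G" "(x, y) \<in> parcs G"
      using zip_tl_rel[OF r(1)] zip_tl_rel[OF s(1)] ab(1) xy(1) by simp_all
    ultimately have "z \<in> p ` ({a, b} \<inter> {x, y})"
      using plane_embedding_edges_meet[OF emb _ _ _ wf] ab(2) xy(2) by blast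
    moreover have "{a, b} \<inter> {x, y} \<subseteq> {u, v}" using mem d by auto
    ultimately show "z \<in> {p u, p v}" by auto
  qed
  have ends: "p u \<in> im r" "p v \<in> im r" if "arc g" "pathstart g = p u" "pathfinish g = p v" "path_image g = im r"
    for g r
    using that by (metis pathstart_in_path_image, metis pathfinish_in_path_image)
  have vs: "u \<in> pverts G" "v \<in> pverts G"
    using path(1) wf ne by (auto simp: vertex_path_def successively_append_iff successively_Cons)
  have drawn: "im r \<subseteq> drawing G p c" if "vertex_path (parcs G) (u # r @ [v])" for r
    using zip_tl_rel[OF that] unfolding im_def drawing_def by auto
  have Fc: "Topological_Spaces.connected F" "F \<inter> drawing G p c = {}"
    using F(1) in_components_connected in_components_subset unfolding faces_def by blast+
  have inner: "\<exists>x. x \<in> im r - {p u, p v} \<and> x \<in> closure F"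
    if r: "vertex_path (parcs G) (u # r @ [v])" "r \<noteq> []" for r
  proof -
    obtain w ws where w: "r = w # ws" using r(2) by (cases r) auto
    have uw: "(u, w) \<in> parcs G" using r(1) by (simp add: w vertex_path_def)
    then have wV: "w \<in> pverts G" using wf by auto
    have "p w \<in> path_image (c (u, w))"
      using emb uw unfolding plane_embedding_def by (metis (mono_tags, lifting) case_prodD pathfinish_in_path_image)
    then have "p w \<in> im r" by (auto simp: im_def w)
    moreover have "w \<noteq> u" "w \<noteq> v" using r(1) by (auto simp: w vertex_path_def)
    then have "p w \<noteq> p u" "p w \<noteq> p v" using inj wV vs by (auto dest: inj_onD)
    moreover have "p w \<in> closure F" using F(2) wV by (auto simp: frontier_def)
    ultimately show ?thesis by blast
  qed
  obtain x1 x2 x3 where "x1 \<in> im r1 - {p u, p v}" "x1 \<in> closure F"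
      "x2 \<in> im r2 - {p u, p v}" "x2 \<in> closure F" "x3 \<in> im r3 - {p u, p v}" "x3 \<in> closure F"
    using inner[OF path(1) ne(1)] inner[OF path(2) ne(2)] inner[OF path(3) ne(3)] by blast
  moreover have "im r1 \<inter> im r2 = {p u, p v}"
    using meet[OF path(1) ne(1) path(2) ne(2) dis(1)] ends[OF g1] ends[OF g2] by blast
  moreover have "im r1 \<inter> im r3 = {p u, p v}"
    using meet[OF path(1) ne(1) path(3) ne(3) dis(2)] ends[OF g1] ends[OF g3] by blast
  moreover have "im r2 \<inter> im r3 = {p u, p v}"
    using meet[OF path(2) ne(2) path(3) ne(3) dis(3)] ends[OF g2] ends[OF g3] by blast
  moreover have "F \<inter> (im r1 \<union> im r2 \<union> im r3) = {}"
    using drawn[OF path(1)] drawn[OF path(2)] drawn[OF path(3)] Fc(2) by blast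
  ultimately show False
    using theta_curve_face[OF g1(1-3) g2(1-3) g3(1-3) _ _ _ Fc(1), unfolded g1(4) g2(4) g3(4)]
    by blast
qed

section \<open>Hamiltonian cycles\<close>

definition vertex_cycle :: "'a rel \<Rightarrow> 'a list \<Rightarrow> bool" where
  "vertex_cycle R xs \<longleftrightarrow> vertex_path R xs \<and> 2 \<le> length xs \<and> (last xs, hd xs) \<in> R"

lemma vertex_path_rev: "sym R \<Longrightarrow> vertex_path R (rev xs) \<longleftrightarrow> vertex_path R xs"
  by (auto simp: vertex_path_def sym_def elim!: successively_mono)

lemma vertex_path_append:
  "vertex_path R (xs @ ys) \<longleftrightarrow> vertex_path R xs \<and> vertex_path R ys \<and> set xs \<inter> set ys = {} \<and>
     (xs = [] \<or> ys = [] \<or> (last xs, hd ys) \<in> R)"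
  by (auto simp: vertex_path_def successively_append_iff)

lemma vertex_path_Cons:
  "vertex_path R (x # xs) \<longleftrightarrow> vertex_path R xs \<and> x \<notin> set xs \<and> (xs = [] \<or> (x, hd xs) \<in> R)"
  by (auto simp: vertex_path_def successively_Cons)

lemma vertex_path_Nil: "vertex_path R []"
  by (simp add: vertex_path_def)

lemmas vertex_path_simps = vertex_path_append vertex_path_Cons vertex_path_Nil

lemma vertex_cycle_rotate:
  assumes "vertex_cycle R (xs @ ys)"
  shows "vertex_cycle R (ys @ xs)"
  using assms by (cases "xs = []"; cases "ys = []") (auto simp: vertex_cycle_def vertex_path_simps)

lemma theta_freeD:
  assumes "theta_free R" "vertex_path R (u # p @ [v])" "vertex_path R (u # q @ [v])" "vertex_path R (u # r @ [v])"
    "set p \<inter> set q = {}" "set p \<inter> set r = {}" "set q \<inter> set r = {}"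
  shows "p = [] \<or> q = [] \<or> r = []"
  using assms unfolding theta_free_def by blast

lemma longest_cycle_spans:
  assumes R: "R \<subseteq> V \<times> V" "sym R" and theta: "theta_free R"
    and con0: "\<And>K. K \<subseteq> V \<Longrightarrow> K \<noteq> {} \<Longrightarrow> K \<noteq> V \<Longrightarrow> \<exists>(x, y) \<in> R. x \<in> K \<and> y \<in> V - K"
    and con1: "\<And>a K. a \<in> V \<Longrightarrow> K \<subseteq> V - {a} \<Longrightarrow> K \<noteq> {} \<Longrightarrow> K \<noteq> V - {a} \<Longrightarrow>
      \<exists>(x, y) \<in> R. x \<in> K \<and> y \<in> V - {a} - K"
    and C: "vertex_cycle R xs" "set xs \<subseteq> V"
    and max: "\<And>ys. vertex_cycle R ys \<Longrightarrow> set ys \<subseteq> V \<Longrightarrow> length ys \<le> length xs"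
  shows "set xs = V"
proof (rule ccontr)
  have sy: "(x, y) \<in> R \<longleftrightarrow> (y, x) \<in> R" for x y using R(2) by (auto simp: sym_def)
  assume "set xs \<noteq> V"
  moreover have "set xs \<noteq> {}" using C(1) by (auto simp: vertex_cycle_def)
  ultimately obtain a y where ay: "(a, y) \<in> R" "a \<in> set xs" "y \<in> V - set xs"
    using con0[of "set xs"] C(2) by blast
  define K where "K = {z. \<exists>P. vertex_path R (y # P) \<and> last (y # P) = z \<and> set (y # P) \<subseteq> V - set xs}"
  have yK: "y \<in> K" using ay(3) by (auto simp: K_def vertex_path_simps intro!: exI[of _ "[]"])
  have KV: "K \<subseteq> V - set xs" unfolding K_def using last_in_set by blast
  have aV: "a \<in> V" using ay(2) C(2) by blast
  obtain b0 where b0: "b0 \<in> set xs" "b0 \<noteq> a"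
  proof -
    have "card (set xs) \<ge> 2" using C(1) by (auto simp: vertex_cycle_def vertex_path_def distinct_card)
    then have "\<not> set xs \<subseteq> {a}"
      by (metis card_mono card.empty card.insert finite.intros not_less_eq_eq numeral_2_eq_2 empty_iff One_nat_def finite_insert)
    then show thesis using that by blast
  qed
  obtain z b where zb: "(z, b) \<in> R" "z \<in> K" "b \<in> V - {a} - K"
    using con1[OF aV, of K] yK KV ay(2) b0 C(2) by blast
  obtain P where P: "vertex_path R (y # P)" "last (y # P) = z" "set (y # P) \<subseteq> V - set xs"
    using zb(2) unfolding K_def by blast
  have b: "b \<in> set xs"
  proof (rule ccontr)
    assume nb: "b \<notin> set xs"
    have "b \<notin> set (y # P)"
    proof
      assume "b \<in> set (y # P)"
      then consider "b = y" | Q S where "P = Q @ b # S" by (auto dest: split_list)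
      then have "b \<in> K"
      proof cases
        case 2
        then show ?thesis using P unfolding K_def mem_Collect_eq
          by (intro exI[of _ "Q @ [b]"]) (auto simp: vertex_path_simps hd_append split: if_splits)
      qed (use yK in simp)
      then show False using zb(3) by simp
    qed
    then have "b \<in> K" using P zb(1,3) nb unfolding K_def mem_Collect_eq
      by (intro exI[of _ "P @ [b]"]) (auto simp: vertex_path_simps hd_append split: if_splits)
    then show False using zb(3) by simp
  qed
  define p where "p = y # P"
  have p: "vertex_path R p" "p \<noteq> []" "hd p = y" "last p = z" "set p \<inter> set xs = {}" "set p \<subseteq> V"
    using P by (auto simp: p_def)
  obtain us vs where usvs: "xs = us @ a # vs" using ay(2) by (auto dest: split_list)
  define c where "c = a # vs @ us"
  have c: "vertex_cycle R c" using vertex_cycle_rotate[of R us "a # vs"] C(1) by (simp add: usvs c_def)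
  have cs: "set c = set xs" "length c = length xs" by (auto simp: usvs c_def)
  have "b \<in> set (vs @ us)" using b zb(3) by (auto simp: usvs)
  then obtain q r where qr: "vs @ us = q @ b # r" using split_list by metis
  have cq: "c = a # q @ b # r" by (simp add: c_def qr)
  have p0: "length p > 0" using p(2) by simp
  have rev_p: "vertex_path R (rev p)" using p(1) vertex_path_rev[OF R(2)] by blast
  have dis: "set p \<inter> set c = {}" using p(5) cs by simp
  consider "q = []" | "r = []" | "q \<noteq> []" "r \<noteq> []" by blast
  then show False
  proof cases
    case 1
    have "vertex_cycle R (a # p @ b # r)"
      using c p zb ay dis unfolding cq 1 vertex_cycle_def by (auto simp: vertex_path_simps)
    moreover have "set (a # p @ b # r) \<subseteq> V" using p(6) cs(1) C(2) by (auto simp: cq 1)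
    ultimately have "length (a # p @ b # r) \<le> length c" unfolding cs(2) by (rule max)
    then show False using p0 by (simp add: cq 1 del: length_greater_0_conv)
  next
    case 2
    have "vertex_cycle R (a # q @ b # rev p)"
      using c p zb ay dis rev_p sy unfolding cq 2 vertex_cycle_def
      by (auto simp: vertex_path_simps hd_rev last_rev hd_append)
    moreover have "set (a # q @ b # rev p) \<subseteq> V" using p(6) cs(1) C(2) by (auto simp: cq 2)
    ultimately have "length (a # q @ b # rev p) \<le> length c" unfolding cs(2) by (rule max)
    then show False using p0 by (simp add: cq 2 del: length_greater_0_conv)
  next
    case 3
    have rr: "vertex_path R (rev r)" using c vertex_path_rev[OF R(2), of r] by (auto simp: vertex_cycle_def cq vertex_path_simps)
    have "vertex_path R (a # p @ [b])" "vertex_path R (a # q @ [b])" "vertex_path R (a # rev r @ [b])"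
      using c p zb ay dis rr sy 3 unfolding cq vertex_cycle_def
      by (auto simp: vertex_path_simps hd_rev last_rev hd_append)
    from theta_freeD[OF theta this] show False
      using 3 p dis c by (auto simp: cq vertex_cycle_def vertex_path_simps)
  qed
qed

lemma crossing_chords_gap:
  assumes R: "sym R" and theta: "theta_free R"
    and c: "vertex_cycle R (a # B @ b # C @ c # D @ d # E)" "(a, c) \<in> R" "(b, d) \<in> R"
  shows "B = []"
proof -
  have sy: "(x, y) \<in> R \<longleftrightarrow> (y, x) \<in> R" for x y using R by (auto simp: sym_def)
  have "vertex_path R (rev C)" "vertex_path R (rev E)"
    using c vertex_path_rev[OF R] by (auto simp: vertex_cycle_def vertex_path_simps)
  then have "vertex_path R (a # B @ [b])" "vertex_path R (a # (c # rev C) @ [b])" "vertex_path R (a # (rev E @ [d]) @ [b])"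
    using c sy unfolding vertex_cycle_def
    by (auto simp: vertex_path_simps hd_rev last_rev hd_append split: if_splits)
  from theta_freeD[OF theta this] show ?thesis
    using c by (auto simp: vertex_cycle_def vertex_path_simps)
qed

lemma no_crossing_chords:
  assumes R: "sym R" and theta: "theta_free R"
    and tri: "\<And>x y z. (x, y) \<in> R \<Longrightarrow> (y, z) \<in> R \<Longrightarrow> (z, x) \<notin> R"
    and c: "vertex_cycle R (A @ a # B @ b # C @ c # D @ d # E)"
  shows "\<not> ((a, c) \<in> R \<and> (b, d) \<in> R)"
proof clarify
  assume e: "(a, c) \<in> R" "(b, d) \<in> R"
  have sy: "(x, y) \<in> R \<longleftrightarrow> (y, x) \<in> R" for x y using R by (auto simp: sym_def)
  have 1: "vertex_cycle R (a # B @ b # C @ c # D @ d # E @ A)" using vertex_cycle_rotate[OF c] by simp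
  then have B: "B = []" using crossing_chords_gap[OF R theta] e by blast
  have 2: "vertex_cycle R (b # C @ c # D @ d # (E @ A) @ a # [])"
    using vertex_cycle_rotate[of R "[a]" "b # C @ c # D @ d # E @ A"] 1 B by simp
  then have C: "C = []" using crossing_chords_gap[OF R theta, of b C c D d "E @ A" a "[]"] e sy by blast
  show False using tri[of a b c] 1 e sy unfolding B C by (auto simp: vertex_cycle_def vertex_path_simps)
qed

lemma drop_split_nth:
  assumes "a \<le> k" "k < length xs"
  shows "drop a xs = take (k - a) (drop a xs) @ xs ! k # drop (Suc k) xs"
  using id_take_nth_drop[of "k - a" "drop a xs"] assms by simp

lemma theta_free_proper_orientation:
  fixes R :: "'a rel"
  assumes V: "finite V" "2 \<le> card V"
    and R: "R \<subseteq> V \<times> V" "sym R" "irrefl R" and theta: "theta_free R"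
    and tri: "\<And>x y z. (x, y) \<in> R \<Longrightarrow> (y, z) \<in> R \<Longrightarrow> (z, x) \<notin> R"
    and con0: "\<And>K. K \<subseteq> V \<Longrightarrow> K \<noteq> {} \<Longrightarrow> K \<noteq> V \<Longrightarrow> \<exists>(x, y) \<in> R. x \<in> K \<and> y \<in> V - K"
    and con1: "\<And>a K. a \<in> V \<Longrightarrow> K \<subseteq> V - {a} \<Longrightarrow> K \<noteq> {} \<Longrightarrow> K \<noteq> V - {a} \<Longrightarrow>
      \<exists>(x, y) \<in> R. x \<in> K \<and> y \<in> V - {a} - K"
  obtains A where "A \<subseteq> R" "\<And>p q. (p, q) \<in> R \<Longrightarrow> (p, q) \<in> A \<longleftrightarrow> (q, p) \<notin> A"
    "\<And>p q. (p, q) \<in> R \<Longrightarrow> card {z. (z, p) \<in> A} \<noteq> card {z. (z, q) \<in> A}"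
    "\<And>p. p \<in> V \<Longrightarrow> card {z. (z, p) \<in> A} \<le> 3"
proof -
  have sy: "(x, y) \<in> R \<longleftrightarrow> (y, x) \<in> R" for x y using R(2) by (auto simp: sym_def)
  obtain x where x: "x \<in> V" using V(2) by fastforce
  moreover have "{x} \<noteq> V" using V(2) by auto
  ultimately obtain y where xy: "(x, y) \<in> R" "y \<in> V - {x}" using con0[of "{x}"] by auto
  have c0: "vertex_cycle R [x, y]" using xy sy by (auto simp: vertex_cycle_def vertex_path_def)
  define Q where "Q xs \<longleftrightarrow> vertex_cycle R xs \<and> set xs \<subseteq> V" for xs
  have "Q [x, y]" using c0 x xy by (simp add: Q_def)
  moreover have "\<forall>xs. Q xs \<longrightarrow> length xs \<le> card V"
    using V(1) by (auto simp: Q_def vertex_cycle_def vertex_path_def distinct_card[symmetric] intro!: card_mono)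
  ultimately obtain xs where xs: "Q xs" "\<And>ys. Q ys \<Longrightarrow> length ys \<le> length xs"
    using ex_has_greatest_nat[of Q "[x, y]" length "Suc (card V)"] by (auto simp: less_Suc_eq_le)
  have cyc: "vertex_cycle R xs" using xs(1) by (simp add: Q_def)
  have set_xs: "set xs = V"
    by (rule longest_cycle_spans[OF R(1,2) theta con0 con1 cyc]) (use xs in \<open>auto simp: Q_def\<close>)
  define n where "n = length xs"
  have n: "2 \<le> n" and dist: "distinct xs" using cyc by (auto simp: n_def vertex_cycle_def vertex_path_def)
  define E where "E = {(i, j). i < n \<and> j < n \<and> (xs ! i, xs ! j) \<in> R}"
  have inj: "xs ! i = xs ! j \<longleftrightarrow> i = j" if "i < n" "j < n" for i j
    using that dist by (simp add: n_def nth_eq_iff_index_eq)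
  have path: "(i, Suc i) \<in> E" if "Suc i < n" for i
    using cyc that by (simp add: E_def n_def vertex_cycle_def vertex_path_def successively_conv_nth)
  have ne: "xs \<noteq> []" using n by (auto simp: n_def)
  have close: "(n - 1, 0) \<in> E"
    using cyc n ne by (simp add: E_def n_def vertex_cycle_def last_conv_nth hd_conv_nth)
  have cross: "(k, l) \<notin> E" if o: "i < k" "k < j" "j < l" "l < n" and e: "(i, j) \<in> E" for i k j l
  proof -
    have "xs = take i xs @ xs ! i # drop (Suc i) xs"
      using drop_split_nth[of 0 i xs] o by (simp add: n_def)
    also have "drop (Suc i) xs = take (k - Suc i) (drop (Suc i) xs) @ xs ! k # drop (Suc k) xs"
      using o by (intro drop_split_nth) (auto simp: n_def)
    also have "drop (Suc k) xs = take (j - Suc k) (drop (Suc k) xs) @ xs ! j # drop (Suc j) xs"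
      using o by (intro drop_split_nth) (auto simp: n_def)
    also have "drop (Suc j) xs = take (l - Suc j) (drop (Suc j) xs) @ xs ! l # drop (Suc l) xs"
      using o by (intro drop_split_nth) (auto simp: n_def)
    finally obtain A B C D F where eq: "xs = A @ xs ! i # B @ xs ! k # C @ xs ! j # D @ xs ! l # F"
      by (rule that)
    have "vertex_cycle R (A @ xs ! i # B @ xs ! k # C @ xs ! j # D @ xs ! l # F)"
      using cyc by (subst (asm) eq)
    from no_crossing_chords[OF R(2) theta tri this] show ?thesis using e by (auto simp: E_def)
  qed
  have E: "sym E" "irrefl E" "E \<subseteq> {..<n} \<times> {..<n}"
    using R sy by (auto simp: E_def sym_def irrefl_def)
  have triE: "(c, a) \<notin> E" if "(a, b) \<in> E" "(b, c) \<in> E" for a b c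
    using tri[of "xs ! a" "xs ! b" "xs ! c"] that by (simp add: E_def)
  obtain B where B: "B \<subseteq> E" "\<And>p q. (p, q) \<in> E \<Longrightarrow> (p, q) \<in> B \<longleftrightarrow> (q, p) \<notin> B"
      "\<And>p q. (p, q) \<in> E \<Longrightarrow> card {z. (z, p) \<in> B} \<noteq> card {z. (z, q) \<in> B}"
      "\<And>p. p < n \<Longrightarrow> card {z. (z, p) \<in> B} \<le> 3"
    by (rule polygon_proper_orientation[OF E path close cross triE]) blast+
  define A where "A = {(xs ! i, xs ! j) | i j. (i, j) \<in> B}"
  have A_iff: "(xs ! i, xs ! j) \<in> A \<longleftrightarrow> (i, j) \<in> B" if "i < n" "j < n" for i j
  proof
    assume "(xs ! i, xs ! j) \<in> A"
    then obtain i' j' where *: "xs ! i = xs ! i'" "xs ! j = xs ! j'" "(i', j') \<in> B"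
      by (auto simp: A_def)
    moreover have "i' < n" "j' < n" using * B(1) E(3) by auto
    ultimately show "(i, j) \<in> B" using inj that by simp
  qed (auto simp: A_def)
  have deg: "card {z. (z, xs ! j) \<in> A} = card {i. (i, j) \<in> B}" if "j < n" for j
  proof -
    have "{z. (z, xs ! j) \<in> A} = (!) xs ` {i. (i, j) \<in> B}"
      using that inj B(1) E(3) by (auto simp: A_def)
    moreover have "inj_on ((!) xs) {i. (i, j) \<in> B}"
      using inj B(1) E(3) by (auto simp: inj_on_def)
    ultimately show ?thesis by (simp add: card_image)
  qed
  have idx: "\<exists>i < n. p = xs ! i" if "p \<in> V" for p
    using that set_xs by (metis in_set_conv_nth n_def)
  have R_idx: "\<exists>i j. i < n \<and> j < n \<and> p = xs ! i \<and> q = xs ! j \<and> (i, j) \<in> E" if "(p, q) \<in> R" for p q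
    using idx[of p] idx[of q] that R(1) by (auto simp: E_def)
  show thesis
  proof (rule that[of A])
    show "A \<subseteq> R" using B(1) by (auto simp: A_def E_def)
    fix p q assume "(p, q) \<in> R"
    then obtain i j where ij: "i < n" "j < n" "p = xs ! i" "q = xs ! j" "(i, j) \<in> E"
      using R_idx by blast
    show "(p, q) \<in> A \<longleftrightarrow> (q, p) \<notin> A" using B(2)[OF ij(5)] ij A_iff by simp
    show "card {z. (z, p) \<in> A} \<noteq> card {z. (z, q) \<in> A}" using B(3)[OF ij(5)] ij deg by simp
  next
    fix p assume "p \<in> V"
    then obtain i where "i < n" "p = xs ! i" using idx by blast
    then show "card {z. (z, p) \<in> A} \<le> 3" using B(4) deg by simp
  qed
qed

lemma connected_cut:
  assumes G: "pair_graph G" and W: "W \<subseteq> pverts G"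
    and con: "Digraph_Component.connected (induce_subgraph (with_proj G) W)"
    and K: "K \<subseteq> W" "K \<noteq> {}" "K \<noteq> W"
  shows "\<exists>(x, y) \<in> parcs G. x \<in> K \<and> y \<in> W - K"
proof (rule ccontr)
  assume "\<not> ?thesis"
  then have no: "y \<in> K" if "(x, y) \<in> parcs G" "x \<in> K" "y \<in> W" for x y using that by blast
  interpret pair_graph G by fact
  let ?H = "mk_symmetric (induce_subgraph (with_proj G) W)"
  have arcs: "(x, y) \<in> parcs G \<and> x \<in> W \<and> y \<in> W" if "(x, y) \<in> parcs ?H" for x y
    using that arcs_symmetric unfolding mk_symmetric_def induce_subgraph_def by auto
  obtain u v where uv: "u \<in> K" "v \<in> W - K" using K by blast
  then have "reachable ?H u v"
    using con K(1) unfolding connected_def strongly_connected_def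
    by (auto simp: mk_symmetric_def induce_subgraph_def)
  then have "(u, v) \<in> rtrancl_on (pverts ?H) (parcs ?H)" by (simp add: reachable_def)
  then have "v \<in> K"
    by (induction rule: rtrancl_on_induct) (use uv(1) no arcs in blast)+
  then show False using uv by blast
qed

lemma in_degree_with_proj: "in_degree (with_proj D) v = card {w. (w, v) \<in> parcs D}"
proof -
  have "in_arcs (with_proj D) v = (\<lambda>w. (w, v)) ` {w. (w, v) \<in> parcs D}"
    by (auto simp: in_arcs_def)
  then show ?thesis unfolding in_degree_def by (simp add: card_image inj_on_def)
qed

lemma proper_orientation_number_le_3:
  assumes G: "pair_graph G" and tri: "triangle_free G" and con: "k_connected 2 G" and outer: "outerplanar G"
  shows "proper_orientation_number G \<le> 3"
proof -
  interpret pair_graph G by fact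
  have R1: "parcs G \<subseteq> pverts G \<times> pverts G" using in_arcsD1 in_arcsD2 by auto
  have R23: "sym (parcs G)" "irrefl (parcs G)"
    using arcs_symmetric no_loops' by (auto simp: sym_def irrefl_def)
  note R = R1 R23
  have tri': "(z, x) \<notin> parcs G" if "(x, y) \<in> parcs G" "(y, z) \<in> parcs G" for x y z
    using tri that unfolding triangle_free_def by blast
  have con': "Digraph_Component.connected (induce_subgraph (with_proj G) (pverts G - X))"
    if "X \<subseteq> pverts G" "card X < 2" for X
    using con that unfolding k_connected_def by blast
  have con0: "\<exists>(x, y) \<in> parcs G. x \<in> K \<and> y \<in> pverts G - K"
    if "K \<subseteq> pverts G" "K \<noteq> {}" "K \<noteq> pverts G" for K
    using connected_cut[OF G _ con'[of "{}"]] that by simp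
  have con1: "\<exists>(x, y) \<in> parcs G. x \<in> K \<and> y \<in> pverts G - {a} - K"
    if "a \<in> pverts G" "K \<subseteq> pverts G - {a}" "K \<noteq> {}" "K \<noteq> pverts G - {a}" for a K
    using connected_cut[OF G _ con'[of "{a}"]] that by simp
  have "2 \<le> card (pverts G)" using con by (simp add: k_connected_def)
  then obtain A where A: "A \<subseteq> parcs G" "\<And>p q. (p, q) \<in> parcs G \<Longrightarrow> (p, q) \<in> A \<longleftrightarrow> (q, p) \<notin> A"
    "\<And>p q. (p, q) \<in> parcs G \<Longrightarrow> card {z. (z, p) \<in> A} \<noteq> card {z. (z, q) \<in> A}"
    "\<And>p. p \<in> pverts G \<Longrightarrow> card {z. (z, p) \<in> A} \<le> 3"
    by (rule theta_free_proper_orientation[OF pair_finite_verts _ R outerplanar_theta_free[OF outer R(1)]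
        tri' con0 con1]) blast+
  define D where "D = \<lparr>pverts = pverts G, parcs = A\<rparr>"
  have "proper_orientation G D"
    using A(1-3) unfolding proper_orientation_def orientation_def in_degree_with_proj
    by (auto simp: D_def)
  moreover have "\<forall>v \<in> pverts G. in_degree (with_proj D) v \<le> 3"
    using A(4) unfolding in_degree_with_proj by (simp add: D_def)
  ultimately show ?thesis unfolding proper_orientation_number_def by (intro Least_le) blast
qed

section \<open>Plane drawings with vertices on a parabola\<close>

definition parabola :: "nat \<Rightarrow> complex" where
  "parabola i = Complex (real i) ((real i)\<^sup>2)"

lemma chord_segment:
  assumes "z \<in> closed_segment (parabola i) (parabola j)" "i < j"
  shows "real i \<le> Re z" "Re z \<le> real j" "Im z = (Re z)\<^sup>2 + (Re z - real i) * (real j - Re z)"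
proof -
  obtain t where t: "0 \<le> t" "t \<le> 1" "z = (1 - t) *\<^sub>R parabola i + t *\<^sub>R parabola j"
    using assms(1) by (auto simp: in_segment)
  have re: "Re z = real i + t * (real j - real i)" and im: "Im z = (real i)\<^sup>2 + t * ((real j)\<^sup>2 - (real i)\<^sup>2)"
    by (simp_all add: t(3) parabola_def algebra_simps)
  have "0 \<le> t * (real j - real i)" "t * (real j - real i) \<le> 1 * (real j - real i)"
    using t(1,2) assms(2) by (auto intro!: mult_right_mono)
  then show "real i \<le> Re z" "Re z \<le> real j" by (auto simp: re)
  show "Im z = (Re z)\<^sup>2 + (Re z - real i) * (real j - Re z)"
    unfolding re im by (simp add: algebra_simps power2_eq_square)
qed

lemma chord_segment_endpoint:
  assumes "z \<in> closed_segment (parabola i) (parabola j)" "i < j" "Re z = real i \<or> Re z = real j"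
  shows "z = parabola i \<or> z = parabola j"
  using chord_segment(3)[OF assms(1,2)] assms(3) by (auto simp: parabola_def complex_eq_iff)

lemma chords_meet:
  assumes z: "z \<in> closed_segment (parabola i) (parabola j)" "z \<in> closed_segment (parabola k) (parabola l)"
    and o: "i < j" "k < l" "(i, j) \<noteq> (k, l)"
    and nc: "\<not> (i < k \<and> k < j \<and> j < l)" "\<not> (k < i \<and> i < l \<and> l < j)"
  shows "z = parabola i \<or> z = parabola j"
proof -
  note 1 = chord_segment[OF z(1) o(1)] and 2 = chord_segment[OF z(2) o(2)]
  define x where "x = Re z"
  have eq: "(x - real i) * (real j - x) = (x - real k) * (real l - x)"
    using 1(3) 2(3) by (simp add: x_def)
  have nested: "x = a \<or> x = b"
    if "a \<le> c" "d \<le> b" "c \<le> x" "x \<le> d" "a \<le> x" "x \<le> b" "(x - a) * (b - x) = (x - c) * (d - x)"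
      "(a, b) \<noteq> (c, d)" for a b c d :: real
  proof -
    have "(x - a) * (b - d) + (c - a) * (d - x) = 0" using that(7) by (simp add: algebra_simps)
    moreover have "0 \<le> (x - a) * (b - d)" "0 \<le> (c - a) * (d - x)" using that by auto
    ultimately have "(x - a) * (b - d) = 0" "(c - a) * (d - x) = 0" by linarith+
    then show ?thesis using that(8) by auto
  qed
  consider "j \<le> k" | "l \<le> i" | "i \<le> k" "l \<le> j" | "k \<le> i" "j \<le> l"
    using nc o by linarith
  then have "x = real i \<or> x = real j"
  proof cases
    case 1
    then show ?thesis using \<open>Re z \<le> real j\<close> 2(1) by (auto simp: x_def)
  next
    case 2
    then show ?thesis using \<open>real i \<le> Re z\<close> \<open>Re z \<le> real l\<close> by (auto simp: x_def)
  next
    case 3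
    then show ?thesis
      using nested[of i k l j] 1(1,2) 2(1,2) o(3) eq by (auto simp: x_def)
  next
    case 4
    then have "x = real k \<or> x = real l"
      using nested[of k i j l] 1(1,2) 2(1,2) o(3) eq by (auto simp: x_def)
    then have "(x - real i) * (real j - x) = 0" using eq by auto
    then show ?thesis by auto
  qed
  then show ?thesis using chord_segment_endpoint[OF z(1) o(1)] by (simp add: x_def)
qed

lemma noncrossing_outerplanar:
  fixes G :: "nat pair_pre_digraph"
  assumes E: "sym (parcs G)" "irrefl (parcs G)" "parcs G \<subseteq> pverts G \<times> pverts G" and ne: "pverts G \<noteq> {}"
    and cross: "\<And>i k j l. i < k \<Longrightarrow> k < j \<Longrightarrow> j < l \<Longrightarrow> (i, j) \<in> parcs G \<Longrightarrow> (k, l) \<notin> parcs G"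
  shows "outerplanar G"
proof -
  define c where "c = (\<lambda>(i, j). linepath (parabola i) (parabola j))"
  let ?V = "parabola ` pverts G" and ?D = "drawing G parabola c"
  have inj: "parabola i = parabola j \<longleftrightarrow> i = j" for i j by (simp add: parabola_def)
  have im: "path_image (c (i, j)) = closed_segment (parabola i) (parabola j)" for i j
    by (simp add: c_def)
  have neq: "i \<noteq> j" if "(i, j) \<in> parcs G" for i j using that E(2) by (auto simp: irrefl_def)
  have on: "z = parabola i \<or> z = parabola j"
    if "z \<in> closed_segment (parabola i) (parabola j)" "z = parabola w" "i < j" for i j z w
    using chord_segment(3)[OF that(1,3)] that(2) by (auto simp: parabola_def)
  have ends: "path_image (c (i, j)) \<inter> ?V = {parabola i, parabola j}" if "(i, j) \<in> parcs G" for i j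
  proof
    show "path_image (c (i, j)) \<inter> ?V \<subseteq> {parabola i, parabola j}"
      using neq[OF that] on[of _ i j] on[of _ j i]
      by (cases i j rule: linorder_cases) (auto simp: im closed_segment_commute)
    show "{parabola i, parabola j} \<subseteq> path_image (c (i, j)) \<inter> ?V"
      using that E(3) by (auto simp: im)
  qed
  have meet: "path_image (c (i, j)) \<inter> path_image (c (k, l)) \<subseteq> ?V"
    if "(i, j) \<in> parcs G" "(k, l) \<in> parcs G" "{i, j} \<noteq> {k, l}" for i j k l
  proof -
    have *: "path_image (c (i, j)) \<inter> path_image (c (k, l)) \<subseteq> ?V"
      if "(i, j) \<in> parcs G" "(k, l) \<in> parcs G" "{i, j} \<noteq> {k, l}" "i < j" "k < l" for i j k l
    proof
      fix z assume z: "z \<in> path_image (c (i, j)) \<inter> path_image (c (k, l))"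
      have "z = parabola i \<or> z = parabola j"
        by (rule chords_meet[of z i j k l]) (use that z cross[of i k j l] cross[of k i l j] in \<open>auto simp: im\<close>)
      then show "z \<in> ?V" using that(1) E(3) by auto
    qed
    have sw: "path_image (c (j, i)) = path_image (c (i, j))" for i j
      by (simp add: im closed_segment_commute)
    have sy: "(j, i) \<in> parcs G" if "(i, j) \<in> parcs G" for i j using that E(1) by (auto simp: sym_def)
    have "i < j \<or> j < i" "k < l \<or> l < k" using neq that(1,2) by (auto simp: neq_iff)
    then show ?thesis
      using *[of i j k l] *[of j i k l] *[of i j l k] *[of j i l k] that sy
        sw[of i j] sw[of k l] by (elim disjE) (simp_all add: insert_commute)
  qed
  have emb: "plane_embedding G parabola c"
    unfolding plane_embedding_def
  proof (intro conjI ballI)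
    show "inj_on parabola (pverts G)" by (auto simp: inj_on_def inj)
  next
    fix e assume e: "e \<in> parcs G"
    obtain i j where ij: "e = (i, j)" by (cases e)
    have *: "path_image (linepath (parabola i) (parabola j)) \<inter> ?V = {parabola i, parabola j}"
      using ends[of i j] e by (simp add: ij c_def)
    show "case e of (u, v) \<Rightarrow> arc (c (u, v)) \<and> pathstart (c (u, v)) = parabola u \<and>
        pathfinish (c (u, v)) = parabola v \<and> c (v, u) = reversepath (c (u, v)) \<and>
        path_image (c (u, v)) \<inter> ?V = {parabola u, parabola v}"
      using neq[of i j] e unfolding ij prod.case c_def
      by (intro conjI *) (auto simp: inj intro: arc_linepath)
  next
    fix e assume e: "e \<in> parcs G"
    obtain i j where ij: "e = (i, j)" by (cases e)
    show "case e of (u, v) \<Rightarrow> \<forall>(x, y) \<in> parcs G. {u, v} \<noteq> {x, y} \<longrightarrow>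
        path_image (c (u, v)) \<inter> path_image (c (x, y)) \<subseteq> ?V"
      using meet e unfolding ij prod.case by blast
  qed
  define B where "B = {z :: complex. Im z < (Re z)\<^sup>2}"
  have B_eq: "B = (\<lambda>z. Complex (Re z) (Im z + (Re z)\<^sup>2)) ` {z. Im z < 0}"
  proof (intro equalityI subsetI)
    fix z assume z: "z \<in> B"
    show "z \<in> (\<lambda>z. Complex (Re z) (Im z + (Re z)\<^sup>2)) ` {z. Im z < 0}"
      by (rule image_eqI[of _ _ "Complex (Re z) (Im z - (Re z)\<^sup>2)"]) (use z in \<open>auto simp: B_def\<close>)
  qed (auto simp: B_def)
  have conB: "Topological_Spaces.connected B"
    unfolding B_eq
    by (intro connected_continuous_image convex_connected convex_halfspace_Im_lt continuous_intros)
  have above: "(Re z)\<^sup>2 \<le> Im z" if zD: "z \<in> ?D" for z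
  proof -
    have *: "(Re z)\<^sup>2 \<le> Im z" if "z \<in> closed_segment (parabola i) (parabola j)" "i < j" for i j
      using chord_segment[OF that] by simp
    from zD consider i where "z = parabola i"
      | i j where "(i, j) \<in> parcs G" "z \<in> closed_segment (parabola i) (parabola j)"
      by (auto simp: drawing_def im)
    then show ?thesis
    proof cases
      case 1
      then show ?thesis by (simp add: parabola_def)
    next
      case 2
      then show ?thesis using *[of i j] *[of j i] neq[OF 2(1)]
        by (cases i j rule: linorder_cases) (auto simp: closed_segment_commute)
    qed
  qed
  then have BD: "B \<subseteq> - ?D" by (force simp: B_def)
  define F where "F = connected_component_set (- ?D) (- \<i>)"
  have iB: "- \<i> \<in> B" by (simp add: B_def)
  have "F \<in> faces G parabola c" using iB BD by (auto simp: faces_def F_def components_def)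
  moreover have BF: "B \<subseteq> F" unfolding F_def using iB conB BD by (rule connected_component_maximal)
  have "?V \<subseteq> frontier F"
  proof
    fix z assume "z \<in> ?V"
    then obtain i where i: "z = parabola i" "i \<in> pverts G" by blast
    have "z \<in> closure B"
      unfolding closure_approachable
    proof (intro allI impI)
      fix e :: real assume e: "0 < e"
      show "\<exists>y \<in> B. dist y z < e"
        using e by (intro bexI[of _ "Complex (real i) ((real i)\<^sup>2 - e / 2)"])
          (auto simp: B_def i parabola_def dist_norm cmod_def)
    qed
    then have "z \<in> closure F" using closure_mono[OF BF] by blast
    moreover have "z \<notin> F" using i connected_component_subset[of "- ?D" "- \<i>"]
      by (auto simp: F_def drawing_def)
    ultimately show "z \<in> frontier F" using interior_subset by (auto simp: frontier_def)
  qed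
  ultimately show ?thesis unfolding outerplanar_def using emb by blast
qed

lemma hamiltonian_2_connected:
  fixes G :: "nat pair_pre_digraph"
  assumes V: "pverts G = {..<n}" "3 \<le> n" and sym: "sym (parcs G)"
    and cyc: "\<And>i. i < n \<Longrightarrow> (i, Suc i mod n) \<in> parcs G"
  shows "k_connected 2 G"
  unfolding k_connected_def
proof (intro conjI allI impI)
  show "2 < card (pverts G)" using V by simp
  fix X assume X: "X \<subseteq> pverts G" "card X < 2"
  let ?H = "mk_symmetric (induce_subgraph (with_proj G) (pverts G - X))"
  obtain s m where m: "0 < m" "pverts G - X = (\<lambda>t. (s + t) mod n) ` {..<m}"
  proof -
    consider "X = {}" | x where "X = {x}" "x < n"
    proof -
      have "finite X" using X(1) V(1) finite_subset by auto
      moreover have "card X = 0 \<or> card X = 1" using X(2) by auto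
      ultimately consider "X = {}" | x where "X = {x}" by (auto simp: card_1_singleton_iff)
      then show thesis using that X(1) V(1) by cases auto
    qed
    then show thesis
    proof cases
      case 1
      then show thesis using V by (intro that[of n 0]) auto
    next
      case 2
      have "{..<n} - {x} = (\<lambda>t. (Suc x + t) mod n) ` {..<n - 1}"
      proof (intro equalityI subsetI)
        fix y assume y: "y \<in> {..<n} - {x}"
        show "y \<in> (\<lambda>t. (Suc x + t) mod n) ` {..<n - 1}"
        proof (cases "x < y")
          case True
          then show ?thesis using y by (intro image_eqI[of _ _ "y - Suc x"]) auto
        next
          case False
          then have "Suc x + (n - Suc x + y) = y + n" using 2 by simp
          then show ?thesis using y False 2
            by (intro image_eqI[of _ _ "n - Suc x + y"]) auto
        qed
      next
        fix y assume "y \<in> (\<lambda>t. (Suc x + t) mod n) ` {..<n - 1}"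
        then obtain t where t: "t < n - 1" "y = (Suc x + t) mod n" by auto
        show "y \<in> {..<n} - {x}"
        proof (cases "Suc x + t < n")
          case True
          then show ?thesis using t(2) by simp
        next
          case False
          then have "y = (Suc x + t - n) mod n" using t(2) by (simp add: le_mod_geq)
          then have "y = Suc x + t - n" using 2 t(1) by simp
          then have "y < x" using t(1) False by linarith
          then show ?thesis using 2 by simp
        qed
      qed
      then show thesis using 2 V by (intro that[of "n - 1" "Suc x"]) auto
    qed
  qed
  define w where "w t = (s + t) mod n" for t
  have H: "pverts ?H = w ` {..<m}" using m(2) by (simp add: mk_symmetric_def w_def)
  have wX: "w t \<in> pverts G - X" if "t < m" for t
    unfolding m(2) w_def using that by blast
  have adj: "(w t, w (Suc t)) \<in> parcs ?H" if "Suc t < m" for t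
  proof -
    have "w t \<in> pverts G - X" "w (Suc t) \<in> pverts G - X" using that wX by auto
    moreover have "(w t, w (Suc t)) \<in> parcs G"
      using cyc[of "w t"] V by (simp add: w_def mod_Suc_eq)
    ultimately show ?thesis by (auto simp: mk_symmetric_def)
  qed
  note symH = symmetric_reachable[OF symmetric_mk_symmetric]
  have w0: "reachable ?H (w 0) (w t)" if "t < m" for t
    using that
  proof (induction t)
    case 0
    then show ?case using wX[of 0] by (auto simp: reachable_def)
  next
    case (Suc t)
    then show ?case
      using adj[of t] wX[of "Suc t"] unfolding reachable_def
      by (auto intro: rtrancl_on.rtrancl_on_into_rtrancl_on)
  qed
  show "Digraph_Component.connected (induce_subgraph (with_proj G) (pverts G - X))"
    unfolding connected_def strongly_connected_def with_proj_simps H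
  proof (intro conjI ballI)
    show "w ` {..<m} \<noteq> {}" using m(1) by auto
    fix u v assume "u \<in> w ` {..<m}" "v \<in> w ` {..<m}"
    then have "reachable ?H u (w 0)" "reachable ?H (w 0) v"
      using symH[OF w0] w0 by blast+
    then show "reachable ?H u v" unfolding reachable_def by (rule rtrancl_on_trans)
  qed
qed

section \<open>A graph that needs in-degree three\<close>

lemma pentagon_base_not_doubly_entered:
  fixes cx c1 c2 c3 cy :: nat
  assumes "cx = of_bool p + of_bool (\<not> a) + of_bool e" "c1 = of_bool a + of_bool b"
    "c2 = of_bool (\<not> b) + of_bool c" "c3 = of_bool (\<not> c) + of_bool d"
    "cy = of_bool q + of_bool (\<not> d) + of_bool (\<not> e)"
    and "cx \<noteq> c1" "c1 \<noteq> c2" "c2 \<noteq> c3" "c3 \<noteq> cy" "cx \<noteq> cy" "cx \<le> 2" "cy \<le> 2"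
  shows "\<not> (p \<and> q)"
proof
  assume "p \<and> q"
  with assms(6-) show False
    unfolding assms(1-5) by (cases a; cases b; cases c; cases d; cases e; simp)
qed

lemma pentagon_saturated:
  fixes c5 c6 c7 c8 c14 :: nat
  assumes "c5 = of_bool i5 + of_bool (\<not> f1) + of_bool (\<not> g)" "c6 = of_bool f1 + of_bool (\<not> f2)"
    "c7 = of_bool f2 + of_bool (\<not> f3)" "c8 = of_bool f3 + of_bool (\<not> h) + of_bool (\<not> f4)"
    "c14 = of_bool i14 + of_bool k + of_bool f4 + of_bool g"
    and "c5 \<noteq> c6" "c6 \<noteq> c7" "c7 \<noteq> c8" "c8 \<noteq> c14" "c5 \<noteq> c14" "c5 \<le> 2" "c8 \<le> 2" "c14 \<le> 2"
    and "\<not> h \<or> k"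
  shows "\<not> i5 \<and> \<not> i14"
  using assms(6-) unfolding assms(1-5)
  by (cases f1; cases f2; cases f3; simp?; cases f4; cases g; simp?; cases h; cases k; simp?;
      cases i5; cases i14; simp)

definition tight_edges :: "(nat \<times> nat) list" where
  "tight_edges = map (\<lambda>i. (i, Suc i)) [0..<14] @ [(0, 14), (0, 4), (5, 14), (8, 14), (9, 13)]"

definition tight_graph :: "nat pair_pre_digraph" where
  "tight_graph = \<lparr>pverts = {..<15}, parcs = set (tight_edges @ map prod.swap tight_edges)\<rparr>"

lemma tight_edges_swap: "(j, i) \<in> parcs tight_graph \<longleftrightarrow> (i, j) \<in> parcs tight_graph"
  by (auto simp: tight_graph_def)

lemma tight_edges_bound: "parcs tight_graph \<subseteq> {..<15} \<times> {..<15}" "irrefl (parcs tight_graph)"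
  by (auto simp: tight_graph_def tight_edges_def irrefl_def)

lemma tight_graph_pair_graph: "pair_graph tight_graph"
proof
  show "fst e \<in> pverts tight_graph" "snd e \<in> pverts tight_graph" if "e \<in> parcs tight_graph" for e
    using that tight_edges_bound(1) by (cases e; auto simp: tight_graph_def)+
  show "finite (pverts tight_graph)" "finite (parcs tight_graph)" by (auto simp: tight_graph_def)
  show "fst e \<noteq> snd e" if "e \<in> parcs tight_graph" for e
    using that tight_edges_bound(2) by (cases e) (auto simp: irrefl_def)
  show "symmetric (with_proj tight_graph)"
    using tight_edges_swap by (auto simp: symmetric_def sym_def)
qed

lemma tight_graph_edge:
  assumes "(i, j) \<in> parcs tight_graph" "i < j"
  shows "j = Suc i \<or> (i, j) \<in> {(0, 14), (0, 4), (5, 14), (8, 14), (9, 13)}"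
  using assms by (auto simp: tight_graph_def tight_edges_def)

lemma tight_graph_triangle_free: "triangle_free tight_graph"
proof -
  have "False" if "(u, v) \<in> parcs tight_graph" "(v, w) \<in> parcs tight_graph" "(u, w) \<in> parcs tight_graph"
      "u < v" "v < w" for u v w
    using tight_graph_edge[OF that(1,4)] tight_graph_edge[OF that(2,5)] tight_graph_edge[OF that(3)] that(4,5)
    by auto
  moreover have "u \<noteq> v" if "(u, v) \<in> parcs tight_graph" for u v
    using that tight_edges_bound(2) by (auto simp: irrefl_def)
  ultimately show ?thesis
    unfolding triangle_free_def using tight_edges_swap by (metis linorder_neqE_nat)
qed

lemma tight_graph_2_connected: "k_connected 2 tight_graph"
proof (rule hamiltonian_2_connected)
  show "pverts tight_graph = {..<15}" by (simp add: tight_graph_def)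
  show "sym (parcs tight_graph)" using tight_edges_swap by (auto simp: sym_def)
  show "(i, Suc i mod 15) \<in> parcs tight_graph" if "i < 15" for i
    using that by (cases "i = 14") (auto simp: tight_graph_def tight_edges_def)
qed simp

lemma tight_graph_outerplanar: "outerplanar tight_graph"
proof (rule noncrossing_outerplanar)
  show "sym (parcs tight_graph)" using tight_edges_swap by (auto simp: sym_def)
  show "irrefl (parcs tight_graph)" "parcs tight_graph \<subseteq> pverts tight_graph \<times> pverts tight_graph"
    "pverts tight_graph \<noteq> {}"
    using tight_edges_bound by (auto simp: tight_graph_def lessThan_empty_iff)
  show "(k, l) \<notin> parcs tight_graph"
    if "i < k" "k < j" "j < l" "(i, j) \<in> parcs tight_graph" for i k j l
    using tight_graph_edge[of i j] tight_graph_edge[of k l] that by auto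
qed

lemma tight_graph_in_degree:
  assumes "A \<subseteq> parcs tight_graph"
    and "filter (\<lambda>w. (w, v) \<in> set (tight_edges @ map prod.swap tight_edges)) [0..<15] = ws"
  shows "card {w. (w, v) \<in> A} = (\<Sum>w\<leftarrow>ws. of_bool ((w, v) \<in> A))"
proof -
  have ws: "distinct ws" "set ws = {w. (w, v) \<in> parcs tight_graph}"
    using assms(2) tight_edges_bound(1) by (auto simp: tight_graph_def)
  then have "{w. (w, v) \<in> A} = {w \<in> set ws. (w, v) \<in> A}" using assms(1) by auto
  also have "card \<dots> = (\<Sum>w \<in> set ws. of_bool ((w, v) \<in> A))"
    by (simp add: of_bool_def sum.If_cases Int_def)
  finally show ?thesis using ws(1) by (simp add: sum_list_distinct_conv_sum_set)
qed

lemma tight_graph_needs_3: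
  assumes D: "proper_orientation tight_graph D"
    and le: "\<forall>v \<in> pverts tight_graph. in_degree (with_proj D) v \<le> 2"
  shows False
proof -
  define A where "A = parcs D"
  define c where "c v = card {w. (w, v) \<in> A}" for v
  have A: "A \<subseteq> parcs tight_graph" using D by (auto simp: proper_orientation_def orientation_def A_def)
  have flip: "(j, i) \<in> A \<longleftrightarrow> (i, j) \<notin> A" if "(i, j) \<in> set tight_edges" for i j
    using D that unfolding proper_orientation_def orientation_def A_def
    by (auto simp: tight_graph_def)
  have ne: "c i \<noteq> c j" if "(i, j) \<in> set tight_edges" for i j
    using D that unfolding proper_orientation_def A_def c_def in_degree_with_proj
    by (auto simp: tight_graph_def)
  have le2: "c v \<le> 2" if "v < 15" for v
    using le that unfolding in_degree_with_proj A_def c_def by (simp add: tight_graph_def)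
  note deg = tight_graph_in_degree[OF A, folded c_def]
  have c: "c 0 = of_bool ((1, 0) \<in> A) + of_bool ((4, 0) \<in> A) + of_bool ((14, 0) \<in> A)"
    "c 1 = of_bool ((0, 1) \<in> A) + of_bool ((2, 1) \<in> A)"
    "c 2 = of_bool ((1, 2) \<in> A) + of_bool ((3, 2) \<in> A)"
    "c 3 = of_bool ((2, 3) \<in> A) + of_bool ((4, 3) \<in> A)"
    "c 4 = of_bool ((0, 4) \<in> A) + of_bool ((3, 4) \<in> A) + of_bool ((5, 4) \<in> A)"
    "c 5 = of_bool ((4, 5) \<in> A) + of_bool ((6, 5) \<in> A) + of_bool ((14, 5) \<in> A)"
    "c 6 = of_bool ((5, 6) \<in> A) + of_bool ((7, 6) \<in> A)"
    "c 7 = of_bool ((6, 7) \<in> A) + of_bool ((8, 7) \<in> A)"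
    "c 8 = of_bool ((7, 8) \<in> A) + of_bool ((9, 8) \<in> A) + of_bool ((14, 8) \<in> A)"
    "c 9 = of_bool ((8, 9) \<in> A) + of_bool ((10, 9) \<in> A) + of_bool ((13, 9) \<in> A)"
    "c 10 = of_bool ((9, 10) \<in> A) + of_bool ((11, 10) \<in> A)"
    "c 11 = of_bool ((10, 11) \<in> A) + of_bool ((12, 11) \<in> A)"
    "c 12 = of_bool ((11, 12) \<in> A) + of_bool ((13, 12) \<in> A)"
    "c 13 = of_bool ((9, 13) \<in> A) + of_bool ((12, 13) \<in> A) + of_bool ((14, 13) \<in> A)"
    "c 14 = of_bool ((0, 14) \<in> A) + of_bool ((5, 14) \<in> A) + of_bool ((8, 14) \<in> A) + of_bool ((13, 14) \<in> A)"
    using deg[of 0 "[1, 4, 14]"] deg[of 1 "[0, 2]"] deg[of 2 "[1, 3]"] deg[of 3 "[2, 4]"]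
      deg[of 4 "[0, 3, 5]"] deg[of 5 "[4, 6, 14]"] deg[of 6 "[5, 7]"] deg[of 7 "[6, 8]"]
      deg[of 8 "[7, 9, 14]"] deg[of 9 "[8, 10, 13]"] deg[of 10 "[9, 11]"] deg[of 11 "[10, 12]"]
      deg[of 12 "[11, 13]"] deg[of 13 "[9, 12, 14]"] deg[of 14 "[0, 5, 8, 13]"]
    by (simp_all add: tight_edges_def upt_rec)
  have e: "(0, 1) \<in> set tight_edges" "(1, 2) \<in> set tight_edges" "(2, 3) \<in> set tight_edges"
    "(3, 4) \<in> set tight_edges" "(4, 5) \<in> set tight_edges" "(5, 6) \<in> set tight_edges"
    "(6, 7) \<in> set tight_edges" "(7, 8) \<in> set tight_edges" "(8, 9) \<in> set tight_edges"
    "(9, 10) \<in> set tight_edges" "(10, 11) \<in> set tight_edges" "(11, 12) \<in> set tight_edges"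
    "(12, 13) \<in> set tight_edges" "(13, 14) \<in> set tight_edges" "(0, 14) \<in> set tight_edges"
    "(0, 4) \<in> set tight_edges" "(5, 14) \<in> set tight_edges" "(8, 14) \<in> set tight_edges"
    "(9, 13) \<in> set tight_edges"
    by (simp_all add: tight_edges_def upt_rec)
  note f = e[THEN flip] and n = e[THEN ne]
  have 1: "\<not> ((14, 0) \<in> A \<and> (5, 4) \<in> A)"
  proof (rule pentagon_base_not_doubly_entered)
    show "c 0 = of_bool ((14, 0) \<in> A) + of_bool ((0, 1) \<notin> A) + of_bool ((4, 0) \<in> A)"
      "c 1 = of_bool ((0, 1) \<in> A) + of_bool ((2, 1) \<in> A)"
      "c 2 = of_bool ((2, 1) \<notin> A) + of_bool ((3, 2) \<in> A)"
      "c 3 = of_bool ((3, 2) \<notin> A) + of_bool ((4, 3) \<in> A)"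
      "c 4 = of_bool ((5, 4) \<in> A) + of_bool ((4, 3) \<notin> A) + of_bool ((4, 0) \<notin> A)"
      unfolding c f by (simp_all only: not_not add_ac)
  qed (simp_all only: n le2, simp_all add: le2)
  have 2: "\<not> ((8, 9) \<in> A \<and> (14, 13) \<in> A)"
  proof (rule pentagon_base_not_doubly_entered)
    show "c 9 = of_bool ((8, 9) \<in> A) + of_bool ((9, 10) \<notin> A) + of_bool ((13, 9) \<in> A)"
      "c 10 = of_bool ((9, 10) \<in> A) + of_bool ((11, 10) \<in> A)"
      "c 11 = of_bool ((11, 10) \<notin> A) + of_bool ((12, 11) \<in> A)"
      "c 12 = of_bool ((12, 11) \<notin> A) + of_bool ((13, 12) \<in> A)"
      "c 13 = of_bool ((14, 13) \<in> A) + of_bool ((13, 12) \<notin> A) + of_bool ((13, 9) \<notin> A)"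
      unfolding c f by (simp_all only: not_not add_ac)
  qed (simp_all only: n le2, simp_all add: le2)
  have 3: "(4, 5) \<notin> A \<and> (0, 14) \<notin> A"
  proof (rule pentagon_saturated)
    show "c 5 = of_bool ((4, 5) \<in> A) + of_bool ((5, 6) \<notin> A) + of_bool ((5, 14) \<notin> A)"
      "c 6 = of_bool ((5, 6) \<in> A) + of_bool ((6, 7) \<notin> A)"
      "c 7 = of_bool ((6, 7) \<in> A) + of_bool ((7, 8) \<notin> A)"
      "c 8 = of_bool ((7, 8) \<in> A) + of_bool ((8, 9) \<notin> A) + of_bool ((8, 14) \<notin> A)"
      "c 14 = of_bool ((0, 14) \<in> A) + of_bool ((13, 14) \<in> A) + of_bool ((8, 14) \<in> A) + of_bool ((5, 14) \<in> A)"
      unfolding c f by (simp_all only: not_not add_ac)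
    show "\<not> (8, 9) \<in> A \<or> (13, 14) \<in> A" using 2 f by blast
  qed (simp_all only: n le2, simp_all add: le2)
  show False using 1 3 f by blast
qed

theorem theorem1:
  shows "(\<forall>G :: 'a pair_pre_digraph.
            pair_graph G \<and> triangle_free G \<and> k_connected 2 G \<and> outerplanar G \<longrightarrow>
            proper_orientation_number G \<le> 3) \<and>
         (\<exists>G :: nat pair_pre_digraph.
            pair_graph G \<and> triangle_free G \<and> k_connected 2 G \<and> outerplanar G \<and>
            proper_orientation_number G = 3)"
proof (intro conjI allI impI exI[of _ tight_graph])
  note tight = tight_graph_pair_graph tight_graph_triangle_free tight_graph_2_connected
    tight_graph_outerplanar
  show "pair_graph tight_graph" "triangle_free tight_graph" "k_connected 2 tight_graph"
    "outerplanar tight_graph"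
    by (fact tight)+
  let ?k = "proper_orientation_number tight_graph"
  obtain D where D: "proper_orientation tight_graph D"
      "\<forall>v \<in> pverts tight_graph. in_degree (with_proj D) v \<le> ?k"
    using LeastI_ex[OF ex_proper_orientation[OF tight(1)]] unfolding proper_orientation_number_def
    by blast
  then have "\<not> ?k \<le> 2" using tight_graph_needs_3[OF D(1)] D(2) le_trans by blast
  then show "?k = 3" using proper_orientation_number_le_3[OF tight] by simp
qed (use proper_orientation_number_le_3 in blast)

end
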